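(* Let $\Gamma$ be a junction, let the data $\lambda>0$, $(H_i)$, $(\nu_{ij})$, $(h_i)$ satisfy the standing assumptions listed in the context (including convexity of the Hamiltonians), and let $B\in\mathbb{R}$. Then every viscosity subsolution (resp. supersolution) of the Kirchhoff problem $$\lambda u(x)-\mathcal{I}_iu(x)+H_i(x,u_{x_i}(x))=0\ \ (x\in E_i,\ 1\le i\le N),\qquad \sum_{i=1}^N-u_{x_i}(O)=B,\qquad u_i(a_i)=h_i\ \ (1\le i\le N)$$ is a viscosity flux-limited (FL) subsolution (resp. FL supersolution), for the flux limiter $FL^-$ associated with $B$.
   Context: **Junction.** Let $d\ge 2$, $N\ge1$, $O=0\in\mathbb{R}^d$, and let $\mathbf{v}_1,\dots,\mathbf{v}_N\in\mathbb{R}^d\setminus\{O\}$ be pairwise non-collinear. Set $E_i=\{t\mathbf{v}_i: t\in(0,1)\}$, $a_i=|\mathbf{v}_i|$, $J_i=(0,a_i)$, $\Gamma=\bigcup_{i=1}^N\bar E_i$, $\gamma_i:[0,a_i]\to\bar E_i$, $\gamma_i(s)=s\,\mathbf{v}_i/a_i$, $x_i=|x|$ for $x\in\bar E_i$. $\rho(x,y)=|x-y|$ if $x,y$ lie in the same $\bar E_i$ and $\rho(x,y)=|x|+|y|$ otherwise. $B_\delta(x)=\{z\in\Gamma:\rho(x,z)<\delta\}$, $B_\delta^c(x)=\Gamma\setminus B_\delta(x)$. **Function spaces.** $u_i=u\circ\gamma_i$. $USC(\Gamma)$ (resp. $LSC(\Gamma)$): all $u_i$ upper (resp. lower) semicontinuous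 on $[0,a_i]$; $C(\Gamma)=USC(\Gamma)\cap LSC(\Gamma)$; $C^1(\Gamma)=\{u\in C(\Gamma):u_i\in C^1([0,a_i])\ \forall i\}$; $u_{x_i}(x)=u_i'(x_i)$ for $x\in\bar E_i$. **Standing assumptions.** $\lambda>0$; $B,h_i\in\mathbb{R}$. $H_i\in C(\bar E_i\times\mathbb{R})$ and there is $C_H>1$ with, for all $i$, $x,y\in\bar E_i$, $p,q\in\mathbb{R}$: $|H_i(x,p)-H_i(y,p)|\le C_H(1+|p|)|x-y|$; $|H_i(x,p)-H_i(x,q)|\le C_H|p-q|$; $C_H^{-1}|p|-C_H\le H_i(x,p)\le C_H(1+|p|)$. Moreover each $p\mapsto H_i(x,p)$ is convex with a unique minimum point $p_i^0(x)$. The $\nu_{ij}:\bar E_i\times(0,\infty)\to[0,\infty)$ are measurable and there are $\Lambda>0$, $\sigma\in(0,1)$ with $0\le\nu_{ij}(x,r)\le\Lambda r^{-1-\sigma}$, $|\nu_{ij}(x,r)-\nu_{ij}(y,r)|\le\Lambda r^{-1-\sigma}|x-y|$ for all $i,j$, $x,y\in\bar E_i$, $r>0$. **Operators.** For measurable $A\subseteq\Gamma$, $x\in\bar E_i$: $\mathcal{I}_i[A]\varphi(x)=\sum_{j=1}^N\int_{\{z\in J_j:\gamma_j(z)\in A\}}[\varphi_j(z)-\varphi(x)]\,\nu_{ij}(x,\rho(x,\gamma_j(z)))\,dz$, $\mathcal{I}_i=\mathcal{I}_i[\Gamma]$. $H_i^-(x,p)=H_i(x,p_i^0(x))$ if $p\le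 p_i^0(x)$ and $=H_i(x,p)$ if $p\ge p_i^0(x)$ (nondecreasing part); $H_i^+(x,p)=H_i(x,p)$ if $p\le p_i^0(x)$ and $=H_i(x,p_i^0(x))$ if $p\ge p_i^0(x)$ (nonincreasing part). Set $G_i^\delta(u,\varphi,p,x)=\lambda u(x)-\mathcal{I}_i[B_\delta^c(x)]u(x)-\mathcal{I}_i[B_\delta(x)]\varphi(x)+H_i(x,p)$, and $G_i^{\pm,\delta}(u,\varphi,p,x)=\lambda u(x)-\mathcal{I}_i[B_\delta^c(x)]u(x)-\mathcal{I}_i[B_\delta(x)]\varphi(x)+H_i^\pm(x,p)$. **Flux limiter.** $FL^{-,\delta}(u,\varphi,O)=\min_{p_1,\dots,p_N\in\mathbb{R}}\max\{\max_{1\le i\le N}G_i^{-,\delta}(u,\varphi,p_i,O),\ \sum_{i=1}^N-p_i-B\}$. (The operator $FL^-$ is its limiting version, where $G_i^{-,\delta}$ is replaced by $\lambda u(O)-\mathcal{I}_iu(O)+H_i^-(O,p_i)$.) **Viscosity solutions of the Kirchhoff problem.** $u\in USC(\Gamma)$ is a viscosity subsolution if for all $x\in\Gamma$, $\delta>0$, $\varphi\in C^1(\Gamma)$ such that $x$ is a maximum point of $u-\varphi$ in $B_\delta(x)$: $G_i^\delta(u,\varphi,\varphi_{x_i}(x),x)\le0$ if $x\in E_i$; $\min\{\min_iG_i^\delta(u,\varphi,\varphi_{x_i}(O),O),\ \sum_i-\varphi_{x_i}(O)-B\}\le0$ if $x=O$; $\min\{G_i^\delta(u,\varphi,\varphi_{x_i}(x),x),\,u(x)-h_i\}\le0$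 if $x=\mathbf{v}_i$. $u\in LSC(\Gamma)$ is a viscosity supersolution if for all $x\in\Gamma$, $\delta>0$, $\varphi\in C^1(\Gamma)$ such that $x$ is a minimum point of $u-\varphi$ in $B_\delta(x)$: $G_i^\delta(u,\varphi,\varphi_{x_i}(x),x)\ge0$ if $x\in E_i$; $\max\{\max_iG_i^\delta(u,\varphi,\varphi_{x_i}(O),O),\ \sum_i-\varphi_{x_i}(O)-B\}\ge0$ if $x=O$; $\max\{G_i^\delta(u,\varphi,\varphi_{x_i}(x),x),\,u(x)-h_i\}\ge0$ if $x=\mathbf{v}_i$. **FL viscosity solutions.** $u\in USC(\Gamma)$ is a viscosity FL subsolution if for all $x\in\Gamma$, $\delta\in(0,1)$, $\varphi\in C^1(\Gamma)$ such that $x$ is a maximum point of $u-\varphi$ in $B_\delta(x)$: $G_i^\delta(u,\varphi,\varphi_{x_i}(x),x)\le0$ if $x\in E_i$; $\max\{\max_iG_i^{+,\delta}(u,\varphi,\varphi_{x_i}(O),O),\ FL^{-,\delta}(u,\varphi,O)\}\le0$ if $x=O$; $\min\{G_i^\delta(u,\varphi,\varphi_{x_i}(x),x),\,u(x)-h_i\}\le0$ if $x=\mathbf{v}_i$. $u\in LSC(\Gamma)$ is a viscosity FL supersolution if for all $x\in\Gamma$, $\delta\in(0,1)$, $\varphi\in C^1(\Gamma)$ such that $x$ is a minimum point of $u-\varphi$ in $B_\delta(x)$: $G_i^\delta(u,\varphi,\varphi_{x_i}(x),x)\ge0$ if $x\in E_i$; $\max\{\max_iG_i^{+,\delta}(u,\varphi,\varphi_{x_i}(O),O),\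 FL^{-,\delta}(u,\varphi,O)\}\ge0$ if $x=O$; $\max\{G_i^\delta(u,\varphi,\varphi_{x_i}(x),x),\,u(x)-h_i\}\ge0$ if $x=\mathbf{v}_i$. *)

theory Defs
  imports "HOL-Analysis.Analysis"
begin

(* The edges are indexed by a finite type 'n, so N = CARD('n) >= 1 is arbitrary; R^d is a Euclidean
   space 'a with d = DIM('a).  Functions on the junction are total functions on 'a, but only their
   values on the junction are ever used. *)

section \<open>Junctions\<close>

definition noncollinear_vectors :: "('n::finite \<Rightarrow> 'a::euclidean_space) \<Rightarrow> bool" where
  "noncollinear_vectors v \<longleftrightarrow> (\<forall>i. v i \<noteq> 0) \<and> (\<forall>i j. i \<noteq> j \<longrightarrow> \<not> collinear {0, v i, v j})"

definition edge :: "('n::finite \<Rightarrow> 'a::euclidean_space) \<Rightarrow> 'n \<Rightarrow> 'a set" where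
  "edge v i = {t *\<^sub>R v i | t. 0 < t \<and> t < 1}"

definition cl_edge :: "('n::finite \<Rightarrow> 'a::euclidean_space) \<Rightarrow> 'n \<Rightarrow> 'a set" where
  "cl_edge v i = closure (edge v i)"

definition junction :: "('n::finite \<Rightarrow> 'a::euclidean_space) \<Rightarrow> 'a set" where
  "junction v = (\<Union>i. cl_edge v i)"

definition param :: "('n::finite \<Rightarrow> 'a::euclidean_space) \<Rightarrow> 'n \<Rightarrow> real \<Rightarrow> 'a" where
  "param v i s = (s / norm (v i)) *\<^sub>R v i"

definition jdist :: "('n::finite \<Rightarrow> 'a::euclidean_space) \<Rightarrow> 'a \<Rightarrow> 'a \<Rightarrow> real" where
  "jdist v x y = (if \<exists>i. x \<in> cl_edge v i \<and> y \<in> cl_edge v i then norm (x - y) else norm x + norm y)"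

definition jball :: "('n::finite \<Rightarrow> 'a::euclidean_space) \<Rightarrow> real \<Rightarrow> 'a \<Rightarrow> 'a set" where
  "jball v \<delta> x = {z \<in> junction v. jdist v x z < \<delta>}"

definition jball_compl :: "('n::finite \<Rightarrow> 'a::euclidean_space) \<Rightarrow> real \<Rightarrow> 'a \<Rightarrow> 'a set" where
  "jball_compl v \<delta> x = junction v - jball v \<delta> x"

section \<open>Function spaces\<close>

definition usc_on :: "real set \<Rightarrow> (real \<Rightarrow> real) \<Rightarrow> bool" where
  "usc_on S f \<longleftrightarrow> (\<forall>s\<in>S. \<forall>c. f s < c \<longrightarrow> (\<forall>\<^sub>F t in at s within S. f t < c))"

definition lsc_on :: "real set \<Rightarrow> (real \<Rightarrow> real) \<Rightarrow> bool" where
  "lsc_on S f \<longleftrightarrow> (\<forall>s\<in>S. \<forall>c. c < f s \<longrightarrow> (\<forall>\<^sub>F t in at s within S. c < f t))"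

definition USC :: "('n::finite \<Rightarrow> 'a::euclidean_space) \<Rightarrow> ('a \<Rightarrow> real) set" where
  "USC v = {u. \<forall>i. usc_on {0..norm (v i)} (u \<circ> param v i)}"

definition LSC :: "('n::finite \<Rightarrow> 'a::euclidean_space) \<Rightarrow> ('a \<Rightarrow> real) set" where
  "LSC v = {u. \<forall>i. lsc_on {0..norm (v i)} (u \<circ> param v i)}"

(* One-sided derivatives at the endpoints of the interval, via "at s within". *)
definition C1 :: "('n::finite \<Rightarrow> 'a::euclidean_space) \<Rightarrow> ('a \<Rightarrow> real) set" where
  "C1 v = {u \<in> USC v \<inter> LSC v. \<forall>i. \<exists>D. continuous_on {0..norm (v i)} D \<and>
      (\<forall>s\<in>{0..norm (v i)}. ((u \<circ> param v i) has_real_derivative D s) (at s within {0..norm (v i)}))}"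

definition edge_deriv :: "('n::finite \<Rightarrow> 'a::euclidean_space) \<Rightarrow> ('a \<Rightarrow> real) \<Rightarrow> 'n \<Rightarrow> 'a \<Rightarrow> real" where
  "edge_deriv v u i x =
     vector_derivative (u \<circ> param v i) (at (norm x) within {0..norm (v i)})"

section \<open>Nonlocal operators and Hamiltonians\<close>

(* Integral with values in the extended reals: positive part minus negative part.  A semicontinuous
   function need not be integrable: for u in USC the integral over the complement of a ball may be
   - infinity, for u in LSC it may be + infinity (but never both signs).  The Bochner integral would
   be 0 in these cases. *)
definition set_ereal_integral :: "real set \<Rightarrow> (real \<Rightarrow> real) \<Rightarrow> ereal" where
  "set_ereal_integral S f =
     enn2ereal (\<integral>\<^sup>+z\<in>S. ennreal (f z) \<partial>lebesgue) - enn2ereal (\<integral>\<^sup>+z\<in>S. ennreal (- f z) \<partial>lebesgue)"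

definition nonlocal ::
  "('n::finite \<Rightarrow> 'a::euclidean_space) \<Rightarrow> ('n \<Rightarrow> 'n \<Rightarrow> 'a \<Rightarrow> real \<Rightarrow> real) \<Rightarrow> 'n \<Rightarrow> 'a set \<Rightarrow>
   ('a \<Rightarrow> real) \<Rightarrow> 'a \<Rightarrow> ereal" where
  "nonlocal v \<nu> i A \<phi> x =
     (\<Sum>j\<in>UNIV. set_ereal_integral {z. 0 < z \<and> z < norm (v j) \<and> param v j z \<in> A}
        (\<lambda>z. (\<phi> (param v j z) - \<phi> x) * \<nu> i j x (jdist v x (param v j z))))"

(* The (unique) minimum point of p \<mapsto> H i x p. *)
definition argmin_H :: "('n \<Rightarrow> 'a \<Rightarrow> real \<Rightarrow> real) \<Rightarrow> 'n \<Rightarrow> 'a \<Rightarrow> real" where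
  "argmin_H H i x = arg_min (H i x) (\<lambda>_. True)"

(* Sign convention: "minus" is the nondecreasing and "plus" the nonincreasing part. *)
definition H_minus :: "('n \<Rightarrow> 'a \<Rightarrow> real \<Rightarrow> real) \<Rightarrow> 'n \<Rightarrow> 'a \<Rightarrow> real \<Rightarrow> real" where
  "H_minus H i x p = (if p \<le> argmin_H H i x then H i x (argmin_H H i x) else H i x p)"

definition H_plus :: "('n \<Rightarrow> 'a \<Rightarrow> real \<Rightarrow> real) \<Rightarrow> 'n \<Rightarrow> 'a \<Rightarrow> real \<Rightarrow> real" where
  "H_plus H i x p = (if p \<le> argmin_H H i x then H i x p else H i x (argmin_H H i x))"

(* Used with H, H_plus H and H_minus H in place of K. *)
definition G ::
  "('n::finite \<Rightarrow> 'a::euclidean_space) \<Rightarrow> real \<Rightarrow> ('n \<Rightarrow> 'n \<Rightarrow> 'a \<Rightarrow> real \<Rightarrow> real) \<Rightarrow>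
   ('n \<Rightarrow> 'a \<Rightarrow> real \<Rightarrow> real) \<Rightarrow> 'n \<Rightarrow> real \<Rightarrow> ('a \<Rightarrow> real) \<Rightarrow> ('a \<Rightarrow> real) \<Rightarrow> real \<Rightarrow> 'a \<Rightarrow> ereal" where
  "G v lam \<nu> K i \<delta> u \<phi> p x =
     ereal (lam * u x) - nonlocal v \<nu> i (jball_compl v \<delta> x) u x
       - nonlocal v \<nu> i (jball v \<delta> x) \<phi> x + ereal (K i x p)"

(* The minimum over (p_1,...,p_N) is written as an infimum in the extended reals.  When the nonlocal
   terms are finite it is attained, because H_minus is continuous, nondecreasing and coercive at
   + infinity in p while the Kirchhoff term is coercive at - infinity. *)
definition FL_minus ::
  "('n::finite \<Rightarrow> 'a::euclidean_space) \<Rightarrow> real \<Rightarrow> ('n \<Rightarrow> 'n \<Rightarrow> 'a \<Rightarrow> real \<Rightarrow> real) \<Rightarrow>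
   ('n \<Rightarrow> 'a \<Rightarrow> real \<Rightarrow> real) \<Rightarrow> real \<Rightarrow> real \<Rightarrow> ('a \<Rightarrow> real) \<Rightarrow> ('a \<Rightarrow> real) \<Rightarrow> ereal" where
  "FL_minus v lam \<nu> H B \<delta> u \<phi> =
     (INF p :: 'n \<Rightarrow> real.
        max (MAX i. G v lam \<nu> (H_minus H) i \<delta> u \<phi> (p i) 0) (ereal ((\<Sum>i\<in>UNIV. - p i) - B)))"

section \<open>Viscosity solutions\<close>

definition max_point_on :: "'a set \<Rightarrow> ('a \<Rightarrow> real) \<Rightarrow> 'a \<Rightarrow> bool" where
  "max_point_on S f x \<longleftrightarrow> (\<forall>z\<in>S. f z \<le> f x)"

definition min_point_on :: "'a set \<Rightarrow> ('a \<Rightarrow> real) \<Rightarrow> 'a \<Rightarrow> bool" where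
  "min_point_on S f x \<longleftrightarrow> (\<forall>z\<in>S. f x \<le> f z)"

definition kirchhoff_subsolution ::
  "('n::finite \<Rightarrow> 'a::euclidean_space) \<Rightarrow> real \<Rightarrow> ('n \<Rightarrow> 'n \<Rightarrow> 'a \<Rightarrow> real \<Rightarrow> real) \<Rightarrow>
   ('n \<Rightarrow> 'a \<Rightarrow> real \<Rightarrow> real) \<Rightarrow> real \<Rightarrow> ('n \<Rightarrow> real) \<Rightarrow> ('a \<Rightarrow> real) \<Rightarrow> bool" where
  "kirchhoff_subsolution v lam \<nu> H B h u \<longleftrightarrow> u \<in> USC v \<and>
     (\<forall>x\<in>junction v. \<forall>\<delta>>0. \<forall>\<phi>\<in>C1 v. max_point_on (jball v \<delta> x) (\<lambda>z. u z - \<phi> z) x \<longrightarrow>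
        (\<forall>i. x \<in> edge v i \<longrightarrow> G v lam \<nu> H i \<delta> u \<phi> (edge_deriv v \<phi> i x) x \<le> 0) \<and>
        (x = 0 \<longrightarrow>
           min (MIN i. G v lam \<nu> H i \<delta> u \<phi> (edge_deriv v \<phi> i 0) 0)
               (ereal ((\<Sum>i\<in>UNIV. - edge_deriv v \<phi> i 0) - B)) \<le> 0) \<and>
        (\<forall>i. x = v i \<longrightarrow>
           min (G v lam \<nu> H i \<delta> u \<phi> (edge_deriv v \<phi> i x) x) (ereal (u x - h i)) \<le> 0))"

definition kirchhoff_supersolution ::
  "('n::finite \<Rightarrow> 'a::euclidean_space) \<Rightarrow> real \<Rightarrow> ('n \<Rightarrow> 'n \<Rightarrow> 'a \<Rightarrow> real \<Rightarrow> real) \<Rightarrow>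
   ('n \<Rightarrow> 'a \<Rightarrow> real \<Rightarrow> real) \<Rightarrow> real \<Rightarrow> ('n \<Rightarrow> real) \<Rightarrow> ('a \<Rightarrow> real) \<Rightarrow> bool" where
  "kirchhoff_supersolution v lam \<nu> H B h u \<longleftrightarrow> u \<in> LSC v \<and>
     (\<forall>x\<in>junction v. \<forall>\<delta>>0. \<forall>\<phi>\<in>C1 v. min_point_on (jball v \<delta> x) (\<lambda>z. u z - \<phi> z) x \<longrightarrow>
        (\<forall>i. x \<in> edge v i \<longrightarrow> G v lam \<nu> H i \<delta> u \<phi> (edge_deriv v \<phi> i x) x \<ge> 0) \<and>
        (x = 0 \<longrightarrow>
           max (MAX i. G v lam \<nu> H i \<delta> u \<phi> (edge_deriv v \<phi> i 0) 0)
               (ereal ((\<Sum>i\<in>UNIV. - edge_deriv v \<phi> i 0) - B)) \<ge> 0) \<and>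
        (\<forall>i. x = v i \<longrightarrow>
           max (G v lam \<nu> H i \<delta> u \<phi> (edge_deriv v \<phi> i x) x) (ereal (u x - h i)) \<ge> 0))"

definition FL_subsolution ::
  "('n::finite \<Rightarrow> 'a::euclidean_space) \<Rightarrow> real \<Rightarrow> ('n \<Rightarrow> 'n \<Rightarrow> 'a \<Rightarrow> real \<Rightarrow> real) \<Rightarrow>
   ('n \<Rightarrow> 'a \<Rightarrow> real \<Rightarrow> real) \<Rightarrow> real \<Rightarrow> ('n \<Rightarrow> real) \<Rightarrow> ('a \<Rightarrow> real) \<Rightarrow> bool" where
  "FL_subsolution v lam \<nu> H B h u \<longleftrightarrow> u \<in> USC v \<and>
     (\<forall>x\<in>junction v. \<forall>\<delta>\<in>{0<..<1}. \<forall>\<phi>\<in>C1 v. max_point_on (jball v \<delta> x) (\<lambda>z. u z - \<phi> z) x \<longrightarrow>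
        (\<forall>i. x \<in> edge v i \<longrightarrow> G v lam \<nu> H i \<delta> u \<phi> (edge_deriv v \<phi> i x) x \<le> 0) \<and>
        (x = 0 \<longrightarrow>
           max (MAX i. G v lam \<nu> (H_plus H) i \<delta> u \<phi> (edge_deriv v \<phi> i 0) 0)
               (FL_minus v lam \<nu> H B \<delta> u \<phi>) \<le> 0) \<and>
        (\<forall>i. x = v i \<longrightarrow>
           min (G v lam \<nu> H i \<delta> u \<phi> (edge_deriv v \<phi> i x) x) (ereal (u x - h i)) \<le> 0))"

definition FL_supersolution ::
  "('n::finite \<Rightarrow> 'a::euclidean_space) \<Rightarrow> real \<Rightarrow> ('n \<Rightarrow> 'n \<Rightarrow> 'a \<Rightarrow> real \<Rightarrow> real) \<Rightarrow>
   ('n \<Rightarrow> 'a \<Rightarrow> real \<Rightarrow> real) \<Rightarrow> real \<Rightarrow> ('n \<Rightarrow> real) \<Rightarrow> ('a \<Rightarrow> real) \<Rightarrow> bool" where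
  "FL_supersolution v lam \<nu> H B h u \<longleftrightarrow> u \<in> LSC v \<and>
     (\<forall>x\<in>junction v. \<forall>\<delta>\<in>{0<..<1}. \<forall>\<phi>\<in>C1 v. min_point_on (jball v \<delta> x) (\<lambda>z. u z - \<phi> z) x \<longrightarrow>
        (\<forall>i. x \<in> edge v i \<longrightarrow> G v lam \<nu> H i \<delta> u \<phi> (edge_deriv v \<phi> i x) x \<ge> 0) \<and>
        (x = 0 \<longrightarrow>
           max (MAX i. G v lam \<nu> (H_plus H) i \<delta> u \<phi> (edge_deriv v \<phi> i 0) 0)
               (FL_minus v lam \<nu> H B \<delta> u \<phi>) \<ge> 0) \<and>
        (\<forall>i. x = v i \<longrightarrow>
           max (G v lam \<nu> H i \<delta> u \<phi> (edge_deriv v \<phi> i x) x) (ereal (u x - h i)) \<ge> 0))"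

section \<open>Standing assumptions\<close>

definition hamiltonian_assms ::
  "('n::finite \<Rightarrow> 'a::euclidean_space) \<Rightarrow> ('n \<Rightarrow> 'a \<Rightarrow> real \<Rightarrow> real) \<Rightarrow> bool" where
  "hamiltonian_assms v H \<longleftrightarrow>
     (\<forall>i. continuous_on (cl_edge v i \<times> UNIV) (\<lambda>(x, p). H i x p)) \<and>
     (\<exists>C>1. \<forall>i. \<forall>x\<in>cl_edge v i. \<forall>y\<in>cl_edge v i. \<forall>p q.
        \<bar>H i x p - H i y p\<bar> \<le> C * (1 + \<bar>p\<bar>) * norm (x - y) \<and>
        \<bar>H i x p - H i x q\<bar> \<le> C * \<bar>p - q\<bar> \<and>
        inverse C * \<bar>p\<bar> - C \<le> H i x p \<and> H i x p \<le> C * (1 + \<bar>p\<bar>)) \<and>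
     (\<forall>i. \<forall>x\<in>cl_edge v i. convex_on UNIV (H i x) \<and> (\<exists>!q. is_arg_min (H i x) (\<lambda>_. True) q))"

(* Measurability is required for the Borel sigma-algebra in x and the Lebesgue sigma-algebra in r.
   By the Lipschitz bound in x this is the same as Lebesgue measurability of every section in r. *)
definition kernel_assms ::
  "('n::finite \<Rightarrow> 'a::euclidean_space) \<Rightarrow> ('n \<Rightarrow> 'n \<Rightarrow> 'a \<Rightarrow> real \<Rightarrow> real) \<Rightarrow> bool" where
  "kernel_assms v \<nu> \<longleftrightarrow>
     (\<forall>i j. set_borel_measurable (borel \<Otimes>\<^sub>M lebesgue) (cl_edge v i \<times> {0<..}) (\<lambda>(x, r). \<nu> i j x r)) \<and>
     (\<exists>\<Lambda>>0. \<exists>\<sigma>. 0 < \<sigma> \<and> \<sigma> < 1 \<and>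
        (\<forall>i j. \<forall>x\<in>cl_edge v i. \<forall>y\<in>cl_edge v i. \<forall>r>0.
           0 \<le> \<nu> i j x r \<and> \<nu> i j x r \<le> \<Lambda> * r powr (- 1 - \<sigma>) \<and>
           \<bar>\<nu> i j x r - \<nu> i j y r\<bar> \<le> \<Lambda> * r powr (- 1 - \<sigma>) * norm (x - y)))"

end

theory Submission
  imports Defs
begin

text \<open>
  Only the vertex \<open>O\<close> needs an argument.  For a Kirchhoff subsolution \<open>u\<close> let \<open>b\<^sub>i\<close> be the critical
  slope of \<open>u\<close> along the \<open>i\<close>-th edge, the infimum of all \<open>p\<close> with
  \<open>u\<^sub>i(z) \<le> u(O) + p z\<close> for small \<open>z\<close>.  Slopes \<open>p\<^sub>i > b\<^sub>i\<close> give an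
  admissible piecewise linear test function at \<open>O\<close>; by coercivity of the Hamiltonians this rules out
  \<open>b\<^sub>i = -\<infinity>\<close>.  Perturbing the line of slope \<open>b\<^sub>i\<close> by
  \<open>\<epsilon> (sqrt (z\<^sup>2 + k\<^sup>2) - k)\<close> and letting \<open>k \<rightarrow> 0\<close>, \<open>u\<close> is touched from above at points of the edge that
  tend to \<open>O\<close>, and reverse Fatou passes to the limit in the nonlocal terms, so the \<open>i\<close>-th equation
  holds at \<open>O\<close> with slope \<open>b\<^sub>i\<close>.  Monotonicity of \<open>H\<^sup>+\<close> gives the first half of the flux-limited
  condition.  For the second half take \<open>q\<^sub>i\<close> to be the largest slope at which the \<open>i\<close>-th equation still
  holds: at slopes above the \<open>q\<^sub>i\<close> all equations fail, so the Kirchhoff inequality must hold there and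
  hence in the limit.  Supersolutions are treated by passing to \<open>-u\<close> and \<open>-H\<^sub>i(x,-p)\<close>, since the two
  statements on test slopes use neither convexity nor coercivity.
\<close>

section \<open>Integrals with values in the extended reals\<close>

text \<open>The Kirchhoff condition at \<open>O\<close> asserts only that one among several
  inequalities holds, whereas the flux-limited condition controls every edge at once. Information on
  one particular edge therefore has to come from the equation inside that edge; the condition at
  \<open>O\<close> is exploited only with slopes at which the equations of all edges fail. A second
  obstacle is the given pair \<delta>, \<phi>. New test functions touch \<open>u\<close> only on a
  smaller ball of radius \<open>d\<close>, while the conclusion refers to \<delta> and \<phi>.
  Returning to them costs a multiple of \<open>d powr (1 - \<sigma>)\<close>, small because \<sigma>
  < 1. The proofs by contradiction start from a strict inequality whose gap absorbs these errors.
  Finally, \<open>u\<close> is only semicontinuous, so far integrals may be infinite. For upper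
  semicontinuous \<open>u\<close> all estimates are one-sided, from above, and the finite integrals
  of positive parts keep the extended-real sums meaningful.\<close>

definition ereal_integral :: "(real \<Rightarrow> real) \<Rightarrow> ereal" where
  "ereal_integral f =
     enn2ereal (\<integral>\<^sup>+z. ennreal (f z) \<partial>lebesgue) - enn2ereal (\<integral>\<^sup>+z. ennreal (- f z) \<partial>lebesgue)"

lemma set_ereal_integral_eq: "set_ereal_integral S f = ereal_integral (\<lambda>z. f z * indicator S z)"
proof -
  have "(\<integral>\<^sup>+z\<in>S. ennreal (g z) \<partial>lebesgue) = (\<integral>\<^sup>+z. ennreal (g z * indicator S z) \<partial>lebesgue)" for g
    by (rule nn_integral_cong) (auto simp: indicator_def)
  from this[of f] this[of "\<lambda>z. - f z"] show ?thesis
    by (simp add: set_ereal_integral_def ereal_integral_def)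
qed

lemma ereal_integral_mono: "(\<And>z. f z \<le> g z) \<Longrightarrow> ereal_integral f \<le> ereal_integral g"
  unfolding ereal_integral_def
  by (intro ereal_minus_mono; unfold less_eq_ennreal.rep_eq[symmetric]; intro nn_integral_mono ennreal_leI)
     simp_all

lemma ereal_integral_le_nn_integral: "ereal_integral f \<le> enn2ereal (\<integral>\<^sup>+z. ennreal (f z) \<partial>lebesgue)"
  unfolding ereal_integral_def
  using ereal_minus_mono[OF order.refl, of 0 "enn2ereal (\<integral>\<^sup>+z. ennreal (- f z) \<partial>lebesgue)"] by simp

text \<open>In \<open>ereal\<close>, \<infinity> - \<infinity> evaluates to \<infinity>, a
  convention that negation does not respect; a finite positive part excludes this case.\<close>

lemma ereal_integral_uminus:
  assumes "(\<integral>\<^sup>+z. ennreal (f z) \<partial>lebesgue) < \<infinity>"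
  shows "ereal_integral (\<lambda>z. - f z) = - ereal_integral f"
proof -
  obtain a where a: "(\<integral>\<^sup>+z. ennreal (f z) \<partial>lebesgue) = ennreal a" "a \<ge> 0"
    using assms by (cases "\<integral>\<^sup>+z. ennreal (f z) \<partial>lebesgue") auto
  show ?thesis
    unfolding ereal_integral_def minus_minus a(1)
    by (cases "enn2ereal (\<integral>\<^sup>+z. ennreal (- f z) \<partial>lebesgue)") (use a(2) in auto)
qed

lemma ereal_integral_less_top:
  assumes "(\<integral>\<^sup>+z. ennreal (f z) \<partial>lebesgue) < \<infinity>"
  shows "ereal_integral f < \<infinity>"
proof -
  have "enn2ereal (\<integral>\<^sup>+z. ennreal (f z) \<partial>lebesgue) < \<infinity>"
    using assms by (cases "\<integral>\<^sup>+z. ennreal (f z) \<partial>lebesgue") auto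
  then show ?thesis using ereal_integral_le_nn_integral[of f] by (rule le_less_trans[rotated])
qed

text \<open>Negative parts may have infinite integral, so terms cannot be moved freely. The proof
  first integrates the identity (f+g)^+ + f^- + g^- = (f+g)^- + f^+ + g^+ between nonnegative
  functions and subtracts only afterwards, using that the three positive parts are finite.\<close>

lemma ereal_integral_add:
  assumes [measurable]: "f \<in> borel_measurable lebesgue" "g \<in> borel_measurable lebesgue"
    and fin: "(\<integral>\<^sup>+z. ennreal (f z) \<partial>lebesgue) < \<infinity>" "(\<integral>\<^sup>+z. ennreal (g z) \<partial>lebesgue) < \<infinity>"
  shows "ereal_integral (\<lambda>z. f z + g z) = ereal_integral f + ereal_integral g"
    and "(\<integral>\<^sup>+z. ennreal (f z + g z) \<partial>lebesgue) < \<infinity>"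
proof -
  define F G S F' G' S' where
    "F = (\<integral>\<^sup>+z. ennreal (f z) \<partial>lebesgue)" and "G = (\<integral>\<^sup>+z. ennreal (g z) \<partial>lebesgue)"
    and "S = (\<integral>\<^sup>+z. ennreal (f z + g z) \<partial>lebesgue)"
    and "F' = (\<integral>\<^sup>+z. ennreal (- f z) \<partial>lebesgue)" and "G' = (\<integral>\<^sup>+z. ennreal (- g z) \<partial>lebesgue)"
    and "S' = (\<integral>\<^sup>+z. ennreal (- (f z + g z)) \<partial>lebesgue)"
  note defs = F_def G_def S_def F'_def G'_def S'_def
  have "S \<le> (\<integral>\<^sup>+z. ennreal (f z) + ennreal (g z) \<partial>lebesgue)"
    unfolding defs
  proof (rule nn_integral_mono)
    fix z
    have "ennreal (f z + g z) \<le> ennreal (max (f z) 0 + max (g z) 0)" by (intro ennreal_leI) auto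
    also have "\<dots> = ennreal (max (f z) 0) + ennreal (max (g z) 0)" by (rule ennreal_plus) auto
    also have "\<dots> = ennreal (f z) + ennreal (g z)" by (auto simp: max_def ennreal_neg)
    finally show "ennreal (f z + g z) \<le> ennreal (f z) + ennreal (g z)" .
  qed
  also have "\<dots> = F + G" unfolding defs by (rule nn_integral_add) measurable
  also have "\<dots> < \<infinity>" using fin by (simp add: defs)
  finally have S: "S < \<infinity>" .
  then show "(\<integral>\<^sup>+z. ennreal (f z + g z) \<partial>lebesgue) < \<infinity>" by (simp add: S_def)
  have "S + (F' + G') = (\<integral>\<^sup>+z. ennreal (f z + g z) + (ennreal (- f z) + ennreal (- g z)) \<partial>lebesgue)"
    unfolding defs by (simp add: nn_integral_add)
  also have "\<dots> = (\<integral>\<^sup>+z. ennreal (- (f z + g z)) + (ennreal (f z) + ennreal (g z)) \<partial>lebesgue)"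
  proof (rule nn_integral_cong)
    fix z
    have *: "ennreal x = ennreal (max x 0)" for x by (auto simp: max_def ennreal_neg)
    show "ennreal (f z + g z) + (ennreal (- f z) + ennreal (- g z)) =
        ennreal (- (f z + g z)) + (ennreal (f z) + ennreal (g z))"
      unfolding *[of "f z + g z"] *[of "- f z"] *[of "- g z"] *[of "- (f z + g z)"] *[of "f z"] *[of "g z"]
      by (simp add: ennreal_plus[symmetric] del: ennreal_plus)
  qed
  also have "\<dots> = S' + (F + G)"
    unfolding defs by (simp add: nn_integral_add)
  finally have eq: "enn2ereal (S + (F' + G')) = enn2ereal (S' + (F + G))" by simp
  have real: "\<exists>r. enn2ereal X = ereal r" if "X < \<infinity>" for X
    using that by (cases X) auto
  have S'0: "enn2ereal X \<noteq> -\<infinity>" for X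
    by (cases X) auto
  have "enn2ereal S - enn2ereal S' = (enn2ereal F - enn2ereal F') + (enn2ereal G - enn2ereal G')"
    using eq S'0 real[OF S] real[OF fin(1)[folded F_def]] real[OF fin(2)[folded G_def]]
    by (cases "enn2ereal S'"; cases "enn2ereal F'"; cases "enn2ereal G'") (auto simp: plus_ennreal.rep_eq)
  then show "ereal_integral (\<lambda>z. f z + g z) = ereal_integral f + ereal_integral g"
    by (simp add: ereal_integral_def defs)
qed

lemma ereal_integral_translate:
  assumes "f \<in> borel_measurable lebesgue"
  shows "ereal_integral (\<lambda>z. f (z - c)) = ereal_integral f"
proof -
  have "(\<integral>\<^sup>+z. ennreal (g (z - c)) \<partial>lebesgue) = (\<integral>\<^sup>+z. ennreal (g z) \<partial>lebesgue)"
    if [measurable]: "g \<in> borel_measurable lebesgue" for g :: "real \<Rightarrow> real"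
    using nn_integral_real_affine_lebesgue[of "\<lambda>z. ennreal (g z)" 1 "-c"] by simp
  from this[of f] this[of "\<lambda>z. - f z"] assms show ?thesis
    by (simp add: ereal_integral_def)
qed

text \<open>Fatou's lemma for the nonnegative functions \<open>g - f k\<close>. Both
  \<open>lim\<close> and the conclusion express a limsup bound as eventual strict inequality below
  every larger number, the form in which upper semicontinuity delivers it; the limit integral may be
  -\<infinity>.\<close>

lemma reverse_Fatou_ereal_integral:
  fixes f :: "nat \<Rightarrow> real \<Rightarrow> real"
  assumes [measurable]: "\<And>k. f k \<in> borel_measurable lebesgue" "f' \<in> borel_measurable lebesgue"
      "g \<in> borel_measurable lebesgue"
    and f_le: "\<And>k z. f k z \<le> g z" and f'_le: "\<And>z. f' z \<le> g z"
    and g: "\<And>z. 0 \<le> g z" "(\<integral>\<^sup>+z. ennreal (g z) \<partial>lebesgue) < \<infinity>"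
    and lim: "AE z in lebesgue. \<forall>c>f' z. \<forall>\<^sub>F k in sequentially. f k z < c"
    and c: "ereal_integral f' < c"
  shows "\<forall>\<^sub>F k in sequentially. ereal_integral (f k) < c"
proof -
  obtain I where I: "(\<integral>\<^sup>+z. ennreal (g z) \<partial>lebesgue) = ennreal I" "I \<ge> 0"
    using g(2) by (cases "\<integral>\<^sup>+z. ennreal (g z) \<partial>lebesgue") auto
  define D where "D = (\<lambda>f. \<integral>\<^sup>+z. ennreal (g z - f z) \<partial>lebesgue)"
  \<comment> \<open>If the negative part of \<open>\<phi>\<close> has infinite integral, both sides
    are -\<infinity>.\<close>
  have E: "ereal_integral \<phi> = ereal I - enn2ereal (D \<phi>)"
    if [measurable]: "\<phi> \<in> borel_measurable lebesgue" and le: "\<And>z. \<phi> z \<le> g z" for \<phi>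
  proof -
    have z: "ennreal (- (g z - \<phi> z)) = 0" "ennreal (- g z) = 0" for z
      using le[of z] g(1)[of z] by (auto simp: ennreal_neg)
    have "ereal_integral (\<lambda>z. g z + - (g z - \<phi> z)) =
        ereal_integral g + ereal_integral (\<lambda>z. - (g z - \<phi> z))"
      using g(2) by (intro ereal_integral_add) (auto simp: z simp del: minus_diff_eq)
    also have "ereal_integral g = ereal I"
      unfolding ereal_integral_def by (simp add: I z zero_ennreal.rep_eq)
    also have "ereal_integral (\<lambda>z. - (g z - \<phi> z)) = - enn2ereal (D \<phi>)"
      unfolding ereal_integral_def D_def z minus_minus by (simp add: zero_ennreal.rep_eq)
    finally show ?thesis by (simp add: minus_ereal_def)
  qed
  have "D f' \<le> (\<integral>\<^sup>+z. liminf (\<lambda>k. ennreal (g z - f k z)) \<partial>lebesgue)"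
    unfolding D_def
  proof (rule nn_integral_mono_AE, use lim in eventually_elim)
    fix z assume *: "\<forall>c>f' z. \<forall>\<^sub>F k in sequentially. f k z < c"
    show "ennreal (g z - f' z) \<le> liminf (\<lambda>k. ennreal (g z - f k z))"
    proof (subst le_Liminf_iff, intro allI impI)
      fix y assume y: "y < ennreal (g z - f' z)"
      then obtain r where r: "y = ennreal r" "r \<ge> 0" by (cases y) auto
      with y have "f' z < g z - r" by (auto simp: ennreal_less_iff)
      with * have "\<forall>\<^sub>F k in sequentially. f k z < g z - r" by blast
      then show "\<forall>\<^sub>F k in sequentially. y < ennreal (g z - f k z)"
        by eventually_elim (use r in \<open>auto simp: ennreal_less_iff\<close>)
    qed
  qed
  also have "\<dots> \<le> liminf (\<lambda>k. D (f k))"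
    unfolding D_def by (rule nn_integral_liminf) measurable
  finally have D: "D f' \<le> liminf (\<lambda>k. D (f k))" .
  have Ef: "ereal_integral (f k) = ereal I - enn2ereal (D (f k))" for k
    by (rule E) (auto intro: f_le)
  have Ef': "ereal_integral f' = ereal I - enn2ereal (D f')"
    by (rule E) (auto intro: f'_le)
  show ?thesis
  proof (cases c)
    case (real r)
    show ?thesis
    proof (cases "r > I")
      case True
      have "ereal I - enn2ereal (D (f k)) \<le> ereal I" for k
        using ereal_minus_mono[of "ereal I" "ereal I" 0 "enn2ereal (D (f k))"] by simp
      then have "ereal_integral (f k) < c" for k
        unfolding Ef real by (rule le_less_trans) (use True in simp)
      then show ?thesis by simp
    next
      case False
      \<comment> \<open>Here \<open>I - r\<close> is nonnegative, so it survives the passage to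
        \<open>ennreal\<close>; for \<open>r > I\<close> the bound holds trivially since
        \<open>D\<close> is nonnegative.\<close>
      have lt: "ereal I - enn2ereal X < c \<longleftrightarrow> ennreal (I - r) < X" for X
        using False unfolding real by (cases X) (auto simp: ennreal_less_iff)
      have "ennreal (I - r) < liminf (\<lambda>k. D (f k))"
        using c D unfolding Ef' lt by (rule less_le_trans)
      then have "\<forall>\<^sub>F k in sequentially. ennreal (I - r) < D (f k)" by (rule less_LiminfD)
      then show ?thesis unfolding Ef lt .
    qed
  next
    case PInf
    have "ereal_integral (f k) < \<infinity>" for k
      unfolding Ef by (cases "D (f k)") auto
    then show ?thesis using PInf by simp
  next
    case MInf
    with c show ?thesis by simp
  qed
qed

text \<open>Allows the limit at the vertex to be taken once, for the sum over all edges, instead of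
  combining limits of extended-valued summands.\<close>

lemma ereal_integral_sum:
  assumes "finite J" "\<And>j. j \<in> J \<Longrightarrow> f j \<in> borel_measurable lebesgue"
    and "\<And>j. j \<in> J \<Longrightarrow> (\<integral>\<^sup>+z. ennreal (f j z) \<partial>lebesgue) < \<infinity>"
  shows "ereal_integral (\<lambda>z. \<Sum>j\<in>J. f j z) = (\<Sum>j\<in>J. ereal_integral (f j))
    \<and> (\<integral>\<^sup>+z. ennreal (\<Sum>j\<in>J. f j z) \<partial>lebesgue) < \<infinity>"
  using assms
proof (induction J rule: finite_induct)
  case empty
  then show ?case by (simp add: ereal_integral_def zero_ennreal.rep_eq)
next
  case (insert j J)
  have m: "f j \<in> borel_measurable lebesgue" "(\<lambda>z. \<Sum>j\<in>J. f j z) \<in> borel_measurable lebesgue"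
    using insert.prems(1) by auto
  have "ereal_integral (\<lambda>z. f j z + (\<Sum>j\<in>J. f j z)) = ereal_integral (f j) + ereal_integral (\<lambda>z. \<Sum>j\<in>J. f j z)"
    "(\<integral>\<^sup>+z. ennreal (f j z + (\<Sum>j\<in>J. f j z)) \<partial>lebesgue) < \<infinity>"
    using ereal_integral_add[OF m] insert by auto
  with insert show ?case by simp
qed

section \<open>Integrability of the dominating functions\<close>

lemma nn_integral_const_interval: "(\<integral>\<^sup>+z. ennreal (C * indicator {a..b::real} z) \<partial>lebesgue) < \<infinity>"
proof -
  have "(\<integral>\<^sup>+z. ennreal (C * indicator {a..b::real} z) \<partial>lebesgue) =
      (\<integral>\<^sup>+z. ennreal C * indicator {a..b} z \<partial>lebesgue)"
    by (intro nn_integral_cong) (auto simp: indicator_def)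
  also have "\<dots> < \<infinity>"
    by (simp add: nn_integral_cmult_indicator ennreal_mult_less_top emeasure_lborel_Icc_eq)
  finally show ?thesis .
qed

text \<open>Each side of \<open>c\<close> contributes the integral of
  \<open>t powr (- \<sigma>)\<close> over \<open>{0..\<delta>}\<close>. This is the source of the
  factor \<open>\<delta> powr (1 - \<sigma>)\<close> in all later error terms.\<close>

lemma nn_integral_abs_powr_le:
  fixes c \<delta> \<sigma> :: real
  assumes "\<sigma> < 1" "\<delta> > 0"
  shows "(\<integral>\<^sup>+t. ennreal (\<bar>t - c\<bar> powr (- \<sigma>) * indicator {t. \<bar>t - c\<bar> < \<delta>} t) \<partial>lebesgue)
    \<le> ennreal (2 * \<delta> powr (1 - \<sigma>) / (1 - \<sigma>))"
proof -
  define f where "f = (\<lambda>t::real. ennreal (indicator {0..\<delta>} t * t powr (- \<sigma>)))"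
  have [measurable]: "f \<in> borel_measurable borel" unfolding f_def by measurable
  have meas[measurable]: "f \<in> borel_measurable lebesgue"
    using measurable_completion[of f lborel borel] by simp
  have "((\<lambda>x. x powr (- \<sigma>)) has_integral (\<delta> powr (- \<sigma> + 1) / (- \<sigma> + 1))) {0..\<delta>}"
    using assms by (intro has_integral_powr_from_0) auto
  from nn_integral_has_integral_lebesgue[OF _ this]
  have f: "(\<integral>\<^sup>+t. f t \<partial>lebesgue) = ennreal (\<delta> powr (1 - \<sigma>) / (1 - \<sigma>))"
    by (simp add: nn_integral_completion f_def add.commute)
  have m: "(\<lambda>t. f (- t)) \<in> borel_measurable lebesgue"
    using measurable_completion[of "\<lambda>t. f (- t)" lborel borel] by simp
  have "(\<integral>\<^sup>+t. f (- t) \<partial>lebesgue) = (\<integral>\<^sup>+t. f t \<partial>lebesgue)"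
    using nn_integral_real_affine_lebesgue[of f "-1" 0] by simp
  then have 2: "(\<integral>\<^sup>+t. f t + f (- t) \<partial>lebesgue) = 2 * (\<integral>\<^sup>+t. f t \<partial>lebesgue)"
    using m by (simp add: nn_integral_add mult_2)
  have m2: "(\<lambda>t. f t + f (- t)) \<in> borel_measurable lebesgue" using m by simp
  have "(\<integral>\<^sup>+t. ennreal (\<bar>t - c\<bar> powr (- \<sigma>) * indicator {t. \<bar>t - c\<bar> < \<delta>} t) \<partial>lebesgue) \<le>
     (\<integral>\<^sup>+t. f (t - c) + f (- (t - c)) \<partial>lebesgue)"
    by (intro nn_integral_mono) (auto simp: f_def indicator_def abs_if)
  also have "\<dots> = (\<integral>\<^sup>+t. f t + f (- t) \<partial>lebesgue)"
    using nn_integral_real_affine_lebesgue[OF m2, of 1 "-c"] by simp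
  also have "\<dots> = ennreal (2 * \<delta> powr (1 - \<sigma>) / (1 - \<sigma>))"
    unfolding 2 f using assms by (simp add: ennreal_mult'' flip: ennreal_numeral times_divide_eq_right)
  finally show ?thesis .
qed

section \<open>Semicontinuous functions and elementary estimates\<close>

lemma usc_on_subset: "usc_on S f \<Longrightarrow> T \<subseteq> S \<Longrightarrow> usc_on T f"
  unfolding usc_on_def by (meson at_le filter_leD subsetD)

lemma usc_on_openin:
  assumes "usc_on S f"
  shows "openin (top_of_set S) {s\<in>S. f s < c}"
proof (subst openin_subopen, safe)
  fix s assume s: "s \<in> S" "f s < c"
  then have "\<forall>\<^sub>F t in at s within S. f t < c" using assms by (auto simp: usc_on_def)
  then obtain U where U: "open U" "s \<in> U" "\<And>t. t \<in> U \<Longrightarrow> t \<noteq> s \<Longrightarrow> t \<in> S \<Longrightarrow> f t < c"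
    by (auto simp: eventually_at_topological)
  show "\<exists>T. openin (top_of_set S) T \<and> s \<in> T \<and> T \<subseteq> {s\<in>S. f s < c}"
    by (rule exI[of _ "S \<inter> U"]) (use U s in auto)
qed

text \<open>If no point were a maximum, the relatively open sets where \<open>f s < f y\<close>
  would cover \<open>S\<close>; in a finite subcover the point \<open>y\<close> with the largest
  value is covered by none of them.\<close>

lemma usc_on_attains_sup:
  assumes usc: "usc_on S f" and S: "compact S" "S \<noteq> {}"
  shows "\<exists>x\<in>S. \<forall>y\<in>S. f y \<le> f x"
proof (rule ccontr)
  assume "\<not> ?thesis"
  then have cover: "\<forall>x\<in>S. \<exists>y\<in>S. f x < f y" by (auto simp: not_le)
  define C where "C = (\<lambda>y. {s\<in>S. f s < f y}) ` S"
  have "(\<forall>c\<in>C. openin (top_of_set S) c) \<and> S \<subseteq> \<Union>C"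
    using usc_on_openin[OF usc] cover by (auto simp: C_def)
  from mp[OF spec[OF S(1)[unfolded compact_eq_openin_cover]] this]
  obtain \<D> where "\<D> \<subseteq> C" "finite \<D>" "S \<subseteq> \<Union>\<D>"
    by (elim exE conjE)
  obtain Y where "Y \<subseteq> S" "finite Y" "\<D> = (\<lambda>y. {s\<in>S. f s < f y}) ` Y"
    using finite_subset_image[OF \<open>finite \<D>\<close> \<open>\<D> \<subseteq> C\<close>[unfolded C_def]] by (elim exE conjE)
  with \<open>S \<subseteq> \<Union>\<D>\<close> have Y: "Y \<subseteq> S" "finite Y" "S \<subseteq> (\<Union>y\<in>Y. {s\<in>S. f s < f y})"
    by simp_all
  with S(2) have "Y \<noteq> {}" by auto
  then have "Max (f ` Y) \<in> f ` Y" using Y(2) by (intro Max_in) auto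
  then obtain y where y: "y \<in> Y" "f y = Max (f ` Y)" by auto
  then obtain y' where "y' \<in> Y" "f y < f y'" using Y by blast
  then show False using y(2) Y(2) by (simp add: leD)
qed

lemma usc_on_borel_measurable:
  assumes usc: "usc_on S f" and S: "S \<in> sets borel"
  shows "(\<lambda>x. f x * indicator S x) \<in> borel_measurable borel"
proof (unfold borel_measurable_iff_less, intro allI)
  fix c :: real
  obtain T where "open T" "{s\<in>S. f s < c} = S \<inter> T"
    using usc_on_openin[OF usc, of c] by (auto simp: openin_open)
  then have "{s\<in>S. f s < c} \<in> sets borel" using S by auto
  then have "{s\<in>S. f s < c} \<union> (if 0 < c then - S else {}) \<in> sets borel" using S by auto
  also have "{s\<in>S. f s < c} \<union> (if 0 < c then - S else {}) = {x \<in> space borel. f x * indicator S x < c}"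
    by (auto simp: indicator_def)
  finally show "{x \<in> space borel. f x * indicator S x < c} \<in> sets borel" .
qed

lemma usc_on_add_continuous:
  assumes "usc_on S f" "continuous_on S g"
  shows "usc_on S (\<lambda>x. f x + g x)"
  unfolding usc_on_def
proof safe
  fix s c assume s: "s \<in> S" "f s + g s < c"
  define e where "e = (c - (f s + g s)) / 2"
  have e: "e > 0" using s by (simp add: e_def)
  have "\<forall>\<^sub>F t in at s within S. f t < f s + e"
    using assms(1) s(1) e unfolding usc_on_def by simp
  moreover have "\<forall>\<^sub>F t in at s within S. g t < g s + e"
    using assms(2) s(1) e unfolding continuous_on_def by (auto intro: order_tendstoD)
  ultimately show "\<forall>\<^sub>F t in at s within S. f t + g t < c"
    by eventually_elim (auto simp: e_def field_simps)
qed

lemma continuous_on_imp_usc_on: "continuous_on S f \<Longrightarrow> usc_on S f"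
  unfolding usc_on_def continuous_on_def by (auto intro: order_tendstoD)

lemma lsc_on_iff_usc_on: "lsc_on S f \<longleftrightarrow> usc_on S (\<lambda>x. - f x)"
proof -
  have "(\<forall>c<f s. \<forall>\<^sub>F t in at s within S. c < f t) \<longleftrightarrow>
      (\<forall>c>-f s. \<forall>\<^sub>F t in at s within S. - f t < c)" for s
  proof safe
    fix c assume *: "\<forall>c<f s. \<forall>\<^sub>F t in at s within S. c < f t" "- f s < c"
    from *(1)[rule_format, of "- c"] *(2) show "\<forall>\<^sub>F t in at s within S. - f t < c"
      by (auto elim: eventually_mono)
  next
    fix c assume *: "\<forall>c>-f s. \<forall>\<^sub>F t in at s within S. - f t < c" "c < f s"
    from *(1)[rule_format, of "- c"] *(2) show "\<forall>\<^sub>F t in at s within S. c < f t"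
      by auto
  qed
  then show ?thesis unfolding usc_on_def lsc_on_def by simp
qed

text \<open>The definition of \<open>usc_on\<close> uses the punctured filter
  \<open>at s within S\<close>. Passing through the relatively open sublevel set admits sequences
  that hit \<open>s\<close> itself.\<close>

lemma usc_on_sequentially:
  assumes "usc_on S f" "s \<in> S" "f s < c" "x \<longlonglongrightarrow> s" "\<forall>\<^sub>F k in sequentially. x k \<in> S"
  shows "\<forall>\<^sub>F k in sequentially. f (x k) < c"
proof -
  obtain T where T: "open T" "{s\<in>S. f s < c} = S \<inter> T"
    using usc_on_openin[OF assms(1), of c] by (auto simp: openin_open)
  then have "\<forall>\<^sub>F k in sequentially. x k \<in> T"
    using assms by (intro topological_tendstoD) auto
  with assms(5) show ?thesis by eventually_elim (use T(2) in blast)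
qed

lemma sum_uminus_ereal:
  fixes f :: "'b \<Rightarrow> ereal"
  assumes "finite J" "\<And>j. j \<in> J \<Longrightarrow> f j < \<infinity>"
  shows "(\<Sum>j\<in>J. - f j) = - (\<Sum>j\<in>J. f j) \<and> (\<Sum>j\<in>J. f j) < \<infinity>"
  using assms
proof (induction J rule: finite_induct)
  case (insert j J)
  then have "f j < \<infinity>" "(\<Sum>j\<in>J. f j) < \<infinity>" "(\<Sum>j\<in>J. - f j) = - (\<Sum>j\<in>J. f j)" by auto
  with insert.hyps show ?case
    by (cases "f j"; cases "\<Sum>j\<in>J. f j") auto
qed simp

text \<open>The sign of \<open>a'\<close> is arbitrary: an upper bound for \<open>a k\<close> may be
  multiplied by \<open>b k\<close> because \<open>b k\<close> is nonnegative. The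
  \<open>b' + 1\<close> in the choice of \<open>e\<close> avoids dividing by zero.\<close>

lemma eventually_mult_less:
  fixes a b :: "nat \<Rightarrow> real"
  assumes b: "b \<longlonglongrightarrow> b'" "\<And>k. 0 \<le> b k"
    and a: "\<And>e. e > 0 \<Longrightarrow> \<forall>\<^sub>F k in sequentially. a k < a' + e"
    and c: "a' * b' < c"
  shows "\<forall>\<^sub>F k in sequentially. a k * b k < c"
proof -
  have b': "0 \<le> b'" using b by (intro LIMSEQ_le_const) auto
  define e where "e = (c - a' * b') / (2 * (b' + 1))"
  have e: "e > 0" using c b' by (simp add: e_def)
  have "e * b' \<le> e * (b' + 1)" using e by simp
  also have "\<dots> = (c - a' * b') / 2" using b' by (simp add: e_def divide_simps)
  also have "\<dots> < c - a' * b'" using c by simp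
  finally have "(a' + e) * b' < c" by (simp add: algebra_simps)
  moreover have "(\<lambda>k. (a' + e) * b k) \<longlonglongrightarrow> (a' + e) * b'" by (intro tendsto_intros b)
  ultimately have "\<forall>\<^sub>F k in sequentially. (a' + e) * b k < c" by (auto intro: order_tendstoD)
  with a[OF e] show ?thesis
    by eventually_elim (use b(2) in \<open>meson le_less_trans less_imp_le mult_right_mono\<close>)
qed

lemma eventually_sum_less:
  fixes f :: "nat \<Rightarrow> 'b \<Rightarrow> real"
  assumes "finite J" "\<And>j c. j \<in> J \<Longrightarrow> f' j < c \<Longrightarrow> \<forall>\<^sub>F k in sequentially. f k j < c"
    and c: "(\<Sum>j\<in>J. f' j) < c"
  shows "\<forall>\<^sub>F k in sequentially. (\<Sum>j\<in>J. f k j) < c"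
proof -
  define e where "e = (c - (\<Sum>j\<in>J. f' j)) / (1 + real (card J))"
  have e: "e > 0" using c by (simp add: e_def add_pos_nonneg)
  have "\<forall>\<^sub>F k in sequentially. \<forall>j\<in>J. f k j < f' j + e"
    using assms(1,2) e by (intro eventually_ball_finite) auto
  then show ?thesis
  proof eventually_elim
    case (elim k)
    have "(\<Sum>j\<in>J. f k j) \<le> (\<Sum>j\<in>J. f' j + e)" using elim by (intro sum_mono) auto
    also have "\<dots> < (\<Sum>j\<in>J. f' j) + e * (1 + real (card J))" using e by (simp add: sum.distrib algebra_simps)
    also have "\<dots> = c" by (simp add: e_def add_pos_nonneg less_imp_neq[symmetric])
    finally show ?case .
  qed
qed

section \<open>Thresholds of slopes and minima of convex functions\<close>

lemma critical_slope_exists: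
  fixes S :: "real set"
  assumes "S \<noteq> {}" "S \<noteq> UNIV" and up: "\<And>p q. p \<in> S \<Longrightarrow> p \<le> q \<Longrightarrow> q \<in> S"
  obtains b where "\<And>p. b < p \<Longrightarrow> p \<in> S" "\<And>p. p < b \<Longrightarrow> p \<notin> S"
proof
  obtain m where m: "m \<notin> S" using assms(2) by auto
  have bdd: "bdd_below S" using m up by (intro bdd_belowI[of _ m]) (meson linear)
  show "p \<in> S" if "Inf S < p" for p
    using that up assms(1) bdd by (meson cInf_less_iff less_imp_le)
  show "p \<notin> S" if "p < Inf S" for p
    using that bdd by (meson cInf_lower leD)
qed

lemma convex_on_towards_minimum:
  fixes f :: "real \<Rightarrow> real"
  assumes "convex_on UNIV f" "\<And>y. f m \<le> f y" "x \<le> y \<and> y \<le> m \<or> m \<le> y \<and> y \<le> x"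
  shows "f y \<le> f x"
proof (cases "x = m")
  case True
  with assms(3) show ?thesis by auto
next
  case False
  define t where "t = (y - x) / (m - x)"
  have t: "0 \<le> t" "t \<le> 1" using False assms(3) by (auto simp: t_def field_simps)
  have "t * (m - x) = y - x" using False by (simp add: t_def)
  then have "y = (1 - t) *\<^sub>R x + t *\<^sub>R m" by (simp add: algebra_simps)
  then have "f y \<le> (1 - t) * f x + t * f m" using convex_onD[OF assms(1) t] by simp
  also have "\<dots> \<le> (1 - t) * f x + t * f x" using t assms(2) by (intro add_left_mono mult_left_mono) auto
  finally show ?thesis by (simp add: algebra_simps)
qed

lemma argmin_H_le:
  assumes "\<exists>!q. is_arg_min (H i x) (\<lambda>_. True) q"
  shows "H i x (argmin_H H i x) \<le> H i x p"
proof -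
  have "is_arg_min (H i x) (\<lambda>_. True) (argmin_H H i x)"
    unfolding argmin_H_def arg_min_def using assms by (metis someI_ex)
  then show ?thesis by (simp add: is_arg_min_def not_less)
qed

section \<open>Test functions on a junction\<close>

lemma param_0 [simp]: "param v i 0 = 0"
  by (simp add: param_def)

text \<open>The distance \<open>\<rho>\<close> between the points with parameters \<open>s\<close> on edge \<open>i\<close> and \<open>t\<close> on edge \<open>j\<close>;
  for \<open>i \<noteq> j\<close> it is only meant for \<open>s, t \<ge> 0\<close>.\<close>

definition edge_dist :: "'n \<Rightarrow> 'n \<Rightarrow> real \<Rightarrow> real \<Rightarrow> real" where
  "edge_dist i j s t = (if i = j then \<bar>t - s\<bar> else t + s)"

lemma edge_dist_0: "0 < z \<Longrightarrow> edge_dist i j 0 z = z"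
  by (simp add: edge_dist_def)

locale junction_vectors =
  fixes v :: "'n::finite \<Rightarrow> 'a::euclidean_space"
  assumes noncollinear: "noncollinear_vectors v"
begin

lemma nz: "v i \<noteq> 0"
  using noncollinear by (simp add: noncollinear_vectors_def)

lemma norm_pos: "0 < norm (v i)"
  using nz by simp

lemma norm_param: "0 \<le> s \<Longrightarrow> norm (param v i s) = s"
  using nz by (simp add: param_def)

lemma edge_eq: "edge v i = param v i ` {0<..<norm (v i)}"
proof safe
  fix x assume "x \<in> edge v i"
  then obtain t where "x = t *\<^sub>R v i" "0 < t" "t < 1" by (auto simp: edge_def)
  then show "x \<in> param v i ` {0<..<norm (v i)}"
    using norm_pos[of i] by (intro image_eqI[of _ _ "t * norm (v i)"]) (auto simp: param_def)
next
  fix s assume "s \<in> {0<..<norm (v i)}"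
  then show "param v i s \<in> edge v i"
    using norm_pos[of i] by (auto simp: param_def edge_def intro!: exI[of _ "s / norm (v i)"])
qed

lemma cl_edge_eq: "cl_edge v i = param v i ` {0..norm (v i)}"
proof -
  have "edge v i = open_segment 0 (v i)"
    using nz[of i] by (auto simp: edge_def in_segment)
  then have *: "cl_edge v i = closed_segment 0 (v i)"
    using nz[of i] by (simp add: cl_edge_def)
  show ?thesis unfolding *
  proof safe
    fix x assume "x \<in> closed_segment 0 (v i)"
    then obtain t where "x = t *\<^sub>R v i" "0 \<le> t" "t \<le> 1" by (auto simp: in_segment)
    then show "x \<in> param v i ` {0..norm (v i)}"
      using norm_pos[of i]
      by (intro image_eqI[of _ _ "t * norm (v i)"]) (auto simp: param_def mult_left_le_one_le)
  next
    fix s assume "s \<in> {0..norm (v i)}"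
    then show "param v i s \<in> closed_segment 0 (v i)"
      using norm_pos[of i] by (auto simp: param_def in_segment intro!: exI[of _ "s / norm (v i)"])
  qed
qed

lemma param_eq_iff:
  assumes "0 \<le> s" "0 \<le> t"
  shows "param v i s = param v j t \<longleftrightarrow> s = t \<and> (i = j \<or> s = 0)"
proof
  assume eq: "param v i s = param v j t"
  then have st: "s = t" using norm_param assms by metis
  moreover have "i = j" if "s \<noteq> 0"
  proof (rule ccontr)
    assume "i \<noteq> j"
    have "v j = (norm (v j) / t) *\<^sub>R param v j t"
      using that st nz[of j] by (simp add: param_def)
    also have "\<dots> = ((norm (v j) / t) * (s / norm (v i))) *\<^sub>R v i"
      unfolding eq[symmetric] by (simp add: param_def)
    finally have "collinear {0, v i, v j}" unfolding collinear_lemma by blast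
    with \<open>i \<noteq> j\<close> noncollinear show False by (simp add: noncollinear_vectors_def)
  qed
  ultimately show "s = t \<and> (i = j \<or> s = 0)" by blast
qed auto

lemma param_in_cl_edge: "0 \<le> s \<Longrightarrow> s \<le> norm (v i) \<Longrightarrow> param v i s \<in> cl_edge v i"
  by (auto simp: cl_edge_eq)

lemma param_in_cl_edge_iff:
  assumes "0 \<le> s" "s \<le> norm (v i)"
  shows "param v i s \<in> cl_edge v k \<longleftrightarrow> k = i \<or> s = 0"
  using assms by (auto simp: cl_edge_eq param_eq_iff image_iff intro: bexI[of _ 0])

lemma jdist_param:
  assumes "0 \<le> s" "s \<le> norm (v i)" "0 \<le> t" "t \<le> norm (v j)"
  shows "jdist v (param v i s) (param v j t) = edge_dist i j s t"
proof (cases "i = j")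
  case True
  have "norm (param v i s - param v i t) = \<bar>s - t\<bar>"
    using nz[of i] by (simp add: param_def scaleR_diff_left[symmetric] diff_divide_distrib[symmetric])
  moreover have "param v i s \<in> cl_edge v i" "param v i t \<in> cl_edge v i"
    using assms True by (auto intro: param_in_cl_edge)
  ultimately show ?thesis
    using True by (auto simp: jdist_def edge_dist_def)
next
  case False
  then show ?thesis
    using assms
    by (auto simp: jdist_def edge_dist_def param_in_cl_edge_iff norm_param)
qed

lemma junction_cases:
  assumes "x \<in> junction v"
  obtains i s where "0 \<le> s" "s \<le> norm (v i)" "x = param v i s"
  using assms by (auto simp: junction_def cl_edge_eq)

lemma param_in_junction: "0 \<le> s \<Longrightarrow> s \<le> norm (v i) \<Longrightarrow> param v i s \<in> junction v"
  using param_in_cl_edge by (auto simp: junction_def)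

lemma param_in_jball_iff:
  assumes "0 \<le> s" "s \<le> norm (v i)" "0 \<le> t" "t \<le> norm (v j)"
  shows "param v j t \<in> jball v \<delta> (param v i s) \<longleftrightarrow> edge_dist i j s t < \<delta>"
    and "param v j t \<in> jball_compl v \<delta> (param v i s) \<longleftrightarrow> \<not> edge_dist i j s t < \<delta>"
  using assms by (simp_all add: jball_def jball_compl_def jdist_param param_in_junction)

section \<open>Gluing, differentiating and bounding functions on the junction\<close>

lemma glue_edge_functions:
  fixes g :: "'n \<Rightarrow> real \<Rightarrow> real"
  assumes "\<And>i. g i 0 = c"
  obtains \<phi> where "\<And>i s. 0 \<le> s \<Longrightarrow> \<phi> (param v i s) = g i s"
proof
  fix i and s :: real assume s: "0 \<le> s"
  \<comment> \<open>The value is unique: two edges share only the point \<open>O\<close>, where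
    every \<open>g i\<close> equals \<open>c\<close>.\<close>
  show "(\<lambda>x. THE y. \<exists>i s. 0 \<le> s \<and> x = param v i s \<and> y = g i s) (param v i s) = g i s"
    using s assms by (auto simp: param_eq_iff intro!: the_equality)
qed

lemma C1I:
  assumes eq: "\<And>i s. 0 \<le> s \<Longrightarrow> \<phi> (param v i s) = g i s"
    and D: "\<And>i s. 0 \<le> s \<Longrightarrow> (g i has_real_derivative D i s) (at s)"
    and cont: "\<And>i. continuous_on {0..} (D i)"
  shows "\<phi> \<in> C1 v"
    and "0 \<le> s \<Longrightarrow> s \<le> norm (v i) \<Longrightarrow> edge_deriv v \<phi> i (param v i s) = D i s"
proof -
  have d: "((\<phi> \<circ> param v i) has_real_derivative D i s) (at s within {0..norm (v i)})"
    if "s \<in> {0..norm (v i)}" for i s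
    by (rule has_field_derivative_transform_within[OF has_field_derivative_at_within[OF D[of s i]], of 1])
       (use that eq in auto)
  then have "continuous_on {0..norm (v i)} (\<phi> \<circ> param v i)" for i
    by (rule DERIV_continuous_on)
  moreover have "continuous_on {0..norm (v i)} (\<lambda>x. - (\<phi> \<circ> param v i) x)" for i
    by (intro continuous_intros calculation)
  ultimately have "\<phi> \<in> USC v \<inter> LSC v"
    by (auto simp: USC_def LSC_def lsc_on_iff_usc_on intro!: continuous_on_imp_usc_on)
  moreover have "continuous_on {0..norm (v i)} (D i)" for i
    by (rule continuous_on_subset[OF cont]) auto
  ultimately show "\<phi> \<in> C1 v" unfolding C1_def using d by blast
  show "edge_deriv v \<phi> i (param v i s) = D i s" if "0 \<le> s" "s \<le> norm (v i)"
    unfolding edge_deriv_def norm_param[OF that(1)]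
    using d[of s i] that norm_pos[of i] vector_derivative_within_cbox[of 0 "norm (v i)" s]
    by (simp add: has_real_derivative_iff_has_vector_derivative)
qed

lemma C1_derivative:
  assumes "\<phi> \<in> C1 v" "0 \<le> s" "s \<le> norm (v i)"
  shows "((\<phi> \<circ> param v i) has_real_derivative edge_deriv v \<phi> i (param v i s))
           (at s within {0..norm (v i)})"
proof -
  obtain D where D: "\<forall>s\<in>{0..norm (v i)}. ((\<phi> \<circ> param v i) has_real_derivative D s) (at s within {0..norm (v i)})"
    using assms(1) by (auto simp: C1_def)
  have "edge_deriv v \<phi> i (param v i s) = D s"
    unfolding edge_deriv_def norm_param[OF assms(2)]
    using D[rule_format, of s] assms(2,3) norm_pos[of i] vector_derivative_within_cbox[of 0 "norm (v i)" s]
    by (simp add: has_real_derivative_iff_has_vector_derivative)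
  with D assms show ?thesis by simp
qed

lemma C1_uminus:
  assumes "\<phi> \<in> C1 v"
  shows "(\<lambda>x. - \<phi> x) \<in> C1 v"
    and "0 \<le> s \<Longrightarrow> s \<le> norm (v i) \<Longrightarrow>
      edge_deriv v (\<lambda>x. - \<phi> x) i (param v i s) = - edge_deriv v \<phi> i (param v i s)"
proof -
  have "\<exists>D. continuous_on {0..norm (v i)} D \<and> (\<forall>s\<in>{0..norm (v i)}.
      (((\<lambda>x. - \<phi> x) \<circ> param v i) has_real_derivative D s) (at s within {0..norm (v i)}))" for i
  proof -
    obtain D where D: "continuous_on {0..norm (v i)} D"
      "\<forall>s\<in>{0..norm (v i)}. ((\<phi> \<circ> param v i) has_real_derivative D s) (at s within {0..norm (v i)})"
      using assms by (auto simp: C1_def)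
    show ?thesis
      by (rule exI[of _ "\<lambda>s. - D s"])
         (use D in \<open>auto simp: o_def intro!: continuous_intros derivative_intros\<close>)
  qed
  moreover have "(\<lambda>x. - \<phi> x) \<in> USC v \<inter> LSC v"
    using assms by (auto simp: C1_def USC_def LSC_def lsc_on_iff_usc_on o_def)
  ultimately show m: "(\<lambda>x. - \<phi> x) \<in> C1 v" unfolding C1_def by blast
  show "edge_deriv v (\<lambda>x. - \<phi> x) i (param v i s) = - edge_deriv v \<phi> i (param v i s)"
    if s: "0 \<le> s" "s \<le> norm (v i)"
  proof -
    have "(((\<lambda>x. - \<phi> x) \<circ> param v i) has_real_derivative - edge_deriv v \<phi> i (param v i s))
           (at s within {0..norm (v i)})"
      using DERIV_minus[OF C1_derivative[OF assms s]] by (simp add: o_def)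
    then show ?thesis
      unfolding edge_deriv_def norm_param[OF s(1)]
      using s norm_pos[of i] vector_derivative_within_cbox[of 0 "norm (v i)" s "(\<lambda>x. - \<phi> x) \<circ> param v i"]
      by (simp add: has_real_derivative_iff_has_vector_derivative)
  qed
qed

text \<open>Within one edge this is the mean value bound. Between different edges the comparison
  goes through \<open>O\<close>, and the two pieces \<open>s\<close> and \<open>t\<close> add up to
  \<open>edge_dist\<close>.\<close>

lemma C1_Lipschitz:
  assumes "\<phi> \<in> C1 v"
  obtains L where "0 \<le> L" "\<And>i j s t. 0 \<le> s \<Longrightarrow> s \<le> norm (v i) \<Longrightarrow> 0 \<le> t \<Longrightarrow> t \<le> norm (v j) \<Longrightarrow>
    \<bar>\<phi> (param v j t) - \<phi> (param v i s)\<bar> \<le> L * edge_dist i j s t"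
proof -
  have "\<exists>L\<ge>0. \<forall>s\<in>{0..norm (v i)}. \<forall>t\<in>{0..norm (v i)}. \<bar>\<phi> (param v i t) - \<phi> (param v i s)\<bar> \<le> L * \<bar>t - s\<bar>" for i
  proof -
    obtain D where D: "continuous_on {0..norm (v i)} D"
      "\<forall>s\<in>{0..norm (v i)}. ((\<phi> \<circ> param v i) has_real_derivative D s) (at s within {0..norm (v i)})"
      using assms by (auto simp: C1_def)
    have "bounded (D ` {0..norm (v i)})"
      using D(1) by (intro compact_imp_bounded compact_continuous_image) auto
    then obtain L where "\<forall>x\<in>D ` {0..norm (v i)}. norm x \<le> L"
      unfolding bounded_iff by (elim exE)
    then have L: "\<And>s. s \<in> {0..norm (v i)} \<Longrightarrow> norm (D s) \<le> L"
      by blast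
    have "L \<ge> 0" using L[of 0] norm_ge_zero[of "D 0"] by auto
    moreover have "norm ((\<phi> \<circ> param v i) t - (\<phi> \<circ> param v i) s) \<le> L * norm (t - s)"
      if "s \<in> {0..norm (v i)}" "t \<in> {0..norm (v i)}" for s t
      by (rule field_differentiable_bound[of "{0..norm (v i)}" _ D]) (use D L that in \<open>auto simp del: o_apply\<close>)
    ultimately show ?thesis by (intro exI[of _ L]) auto
  qed
  then obtain L where L0: "\<And>i. L i \<ge> 0" and L: "\<And>i s t. s \<in> {0..norm (v i)} \<Longrightarrow> t \<in> {0..norm (v i)} \<Longrightarrow>
      \<bar>\<phi> (param v i t) - \<phi> (param v i s)\<bar> \<le> L i * \<bar>t - s\<bar>"
    by metis
  define M where "M = Max (range L)"
  have M: "L i \<le> M" for i unfolding M_def by (rule Max_ge) auto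
  have LM: "\<bar>\<phi> (param v i t) - \<phi> (param v i s)\<bar> \<le> M * \<bar>t - s\<bar>"
    if "s \<in> {0..norm (v i)}" "t \<in> {0..norm (v i)}" for i s t
    using L[OF that] mult_right_mono[OF M[of i], of "\<bar>t - s\<bar>"] by simp
  show ?thesis
  proof (rule that)
    show "0 \<le> M" using L0 M order_trans by blast
    fix i j s t assume *: "0 \<le> s" "s \<le> norm (v i)" "0 \<le> t" "t \<le> norm (v j)"
    show "\<bar>\<phi> (param v j t) - \<phi> (param v i s)\<bar> \<le> M * edge_dist i j s t"
      using LM[of s i t] LM[of 0 i s] LM[of 0 j t] *
      by (auto simp: edge_dist_def algebra_simps)
  qed
qed

lemma USC_bounded_above:
  assumes "u \<in> USC v"
  obtains M where "\<And>i s. 0 \<le> s \<Longrightarrow> s \<le> norm (v i) \<Longrightarrow> u (param v i s) \<le> M"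
proof -
  have "\<exists>m. \<forall>s\<in>{0..norm (v i)}. u (param v i s) \<le> m" for i
    using usc_on_attains_sup[of "{0..norm (v i)}" "u \<circ> param v i"] assms
    by (auto simp: USC_def)
  then obtain m where m: "\<And>i s. s \<in> {0..norm (v i)} \<Longrightarrow> u (param v i s) \<le> m i" by metis
  have "u (param v i s) \<le> Max (range m)" if "0 \<le> s" "s \<le> norm (v i)" for i s
    by (rule order_trans[OF m[of s i] Max_ge]) (use that in auto)
  then show ?thesis using that by blast
qed

end

section \<open>The nonlocal operator\<close>

locale junction_kernel = junction_vectors v
  for v :: "'n::finite \<Rightarrow> 'a::euclidean_space" +
  fixes \<nu> :: "'n \<Rightarrow> 'n \<Rightarrow> 'a \<Rightarrow> real \<Rightarrow> real" and \<Lambda> \<sigma> :: real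
  assumes kernel_meas:
      "\<And>i j. set_borel_measurable (borel \<Otimes>\<^sub>M lebesgue) (cl_edge v i \<times> {0<..}) (\<lambda>(x, r). \<nu> i j x r)"
    and \<Lambda>: "0 < \<Lambda>" and \<sigma>: "0 < \<sigma>" "\<sigma> < 1"
    and kernel_nonneg: "\<And>i j x r. x \<in> cl_edge v i \<Longrightarrow> 0 < r \<Longrightarrow> 0 \<le> \<nu> i j x r"
    and kernel_le: "\<And>i j x r. x \<in> cl_edge v i \<Longrightarrow> 0 < r \<Longrightarrow> \<nu> i j x r \<le> \<Lambda> * r powr (- 1 - \<sigma>)"
    and kernel_Lipschitz: "\<And>i j x y r. x \<in> cl_edge v i \<Longrightarrow> y \<in> cl_edge v i \<Longrightarrow> 0 < r \<Longrightarrow>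
      \<bar>\<nu> i j x r - \<nu> i j y r\<bar> \<le> \<Lambda> * r powr (- 1 - \<sigma>) * norm (x - y)"
begin

lemma kernel_section_measurable:
  assumes "x \<in> cl_edge v i"
  shows "(\<lambda>r. \<nu> i j x r * indicator {0<..} r) \<in> borel_measurable lebesgue"
proof -
  have "(\<lambda>r. indicator (cl_edge v i \<times> {0<..}) (x, r) *\<^sub>R (case (x, r) of (x, r) \<Rightarrow> \<nu> i j x r))
      \<in> borel_measurable lebesgue"
    using measurable_compose[OF measurable_Pair1'[of x borel lebesgue] kernel_meas[of i j, unfolded set_borel_measurable_def]]
    by simp
  also have "(\<lambda>r. indicator (cl_edge v i \<times> {0<..}) (x, r) *\<^sub>R (case (x, r) of (x, r) \<Rightarrow> \<nu> i j x r)) =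
      (\<lambda>r. \<nu> i j x r * indicator {0<..} r)"
    using assms by (auto simp: indicator_def)
  finally show ?thesis .
qed

lemma USC_edge_measurable:
  assumes "u \<in> USC v"
  shows "(\<lambda>z. u (param v j (z + c)) * indicator {0<..<norm (v j)} (z + c)) \<in> borel_measurable lebesgue"
proof -
  have "usc_on {0<..<norm (v j)} (u \<circ> param v j)"
    using assms by (auto simp: USC_def intro: usc_on_subset)
  from usc_on_borel_measurable[OF this]
  have "(\<lambda>z. u (param v j z) * indicator {0<..<norm (v j)} z) \<in> borel_measurable borel" by simp
  from measurable_compose[OF _ this, of "\<lambda>z. z + c" borel]
  have "(\<lambda>z. u (param v j (z + c)) * indicator {0<..<norm (v j)} (z + c)) \<in> borel_measurable borel"
    by simp
  then show ?thesis using measurable_completion[of _ lborel borel] by simp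
qed

text \<open>The region of integration is a condition \<open>P\<close> on the distance rather than a
  subset of the junction, so that balls and their complements are treated by the same function of
  real parameters.\<close>

definition integrand :: "'n \<Rightarrow> 'n \<Rightarrow> real \<Rightarrow> (real \<Rightarrow> bool) \<Rightarrow> ('a \<Rightarrow> real) \<Rightarrow> real \<Rightarrow> real" where
  "integrand i j s P w z = (w (param v j z) - w (param v i s)) * \<nu> i j (param v i s) (edge_dist i j s z)
     * indicator {z. 0 < z \<and> z < norm (v j) \<and> P (edge_dist i j s z)} z"

lemma nonlocal_eq:
  assumes "0 \<le> s" "s \<le> norm (v i)"
  shows "nonlocal v \<nu> i (jball v \<delta> (param v i s)) w (param v i s) =
      (\<Sum>j\<in>UNIV. ereal_integral (integrand i j s (\<lambda>r. r < \<delta>) w))"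
    and "nonlocal v \<nu> i (jball_compl v \<delta> (param v i s)) w (param v i s) =
      (\<Sum>j\<in>UNIV. ereal_integral (integrand i j s (\<lambda>r. \<not> r < \<delta>) w))"
  unfolding nonlocal_def set_ereal_integral_eq
  by (intro sum.cong arg_cong[of _ _ ereal_integral] ext refl;
      use assms in \<open>auto simp: integrand_def indicator_def param_in_jball_iff jdist_param\<close>)+

lemma integrand_uminus: "integrand i j s P (\<lambda>x. - w x) = (\<lambda>z. - integrand i j s P w z)"
  by (auto simp: integrand_def algebra_simps)

section \<open>Domination and finiteness of the nonlocal integrals\<close>

lemma integrand_far_le:
  assumes "0 \<le> s" "s \<le> norm (v i)" "0 < \<delta>"
    and M: "\<And>j z. 0 \<le> z \<Longrightarrow> z \<le> norm (v j) \<Longrightarrow> w (param v j z) \<le> M"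
  shows "integrand i j s (\<lambda>r. \<not> r < \<delta>) w z
     \<le> (M - w (param v i s)) * (\<Lambda> * \<delta> powr (- 1 - \<sigma>)) * indicator {0..norm (v j)} z"
proof (cases "0 < z \<and> z < norm (v j) \<and> \<not> edge_dist i j s z < \<delta>")
  case True
  let ?r = "edge_dist i j s z"
  have x: "param v i s \<in> cl_edge v i" using assms by (intro param_in_cl_edge)
  have r: "0 < ?r" "\<delta> \<le> ?r" using True assms(3) by auto
  have "\<nu> i j (param v i s) ?r \<le> \<Lambda> * ?r powr (- 1 - \<sigma>)" using kernel_le[OF x r(1)] .
  also have "\<dots> \<le> \<Lambda> * \<delta> powr (- 1 - \<sigma>)"
    using r \<Lambda> \<sigma> assms(3) by (intro mult_left_mono powr_mono2') auto
  finally have "(w (param v j z) - w (param v i s)) * \<nu> i j (param v i s) ?r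
      \<le> (M - w (param v i s)) * (\<Lambda> * \<delta> powr (- 1 - \<sigma>))"
    using kernel_nonneg[OF x r(1)] M[of z j] M[of s i] True assms
    by (intro mult_mono) auto
  then show ?thesis using True by (simp add: integrand_def)
next
  case False
  have "0 \<le> M - w (param v i s)" using M[of s i] assms by simp
  then have "0 \<le> (M - w (param v i s)) * (\<Lambda> * \<delta> powr (- 1 - \<sigma>)) * indicator {0..norm (v j)} z"
    using \<Lambda> by simp
  then show ?thesis using False by (auto simp: integrand_def)
qed

lemma integrand_far_finite:
  assumes "0 \<le> s" "s \<le> norm (v i)" "0 < \<delta>" "u \<in> USC v"
  shows "(\<integral>\<^sup>+z. ennreal (integrand i j s (\<lambda>r. \<not> r < \<delta>) u z) \<partial>lebesgue) < \<infinity>"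
proof -
  obtain M where "\<And>i s. 0 \<le> s \<Longrightarrow> s \<le> norm (v i) \<Longrightarrow> u (param v i s) \<le> M"
    using USC_bounded_above[OF assms(4)] by blast
  from integrand_far_le[OF assms(1-3), of u, OF this]
  show ?thesis
    by (intro le_less_trans[OF nn_integral_mono nn_integral_const_interval] ennreal_leI)
qed

text \<open>Growth at most \<open>L * r\<close> times the kernel bound
  \<open>\<Lambda> * r powr (- 1 - \<sigma>)\<close> leaves the integrable power
  \<open>r powr (- \<sigma>)\<close>. The centre \<open>- s\<close> for \<open>i \<noteq> j\<close>
  writes the distance \<open>z + s\<close> across the vertex as an absolute value, so one singular
  integral covers both cases.\<close>

lemma integrand_near_le:
  assumes "0 \<le> s" "s \<le> norm (v i)"
    and le: "\<And>z. 0 < z \<Longrightarrow> z < norm (v j) \<Longrightarrow> edge_dist i j s z < \<delta> \<Longrightarrow>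
      w (param v j z) - w (param v i s) \<le> L * edge_dist i j s z"
    and "0 \<le> L" "P = (\<lambda>r. r < \<delta>)"
  shows "integrand i j s P w z \<le> L * \<Lambda> * (\<bar>z - (if i = j then s else - s)\<bar> powr (- \<sigma>)
     * indicator {z. \<bar>z - (if i = j then s else - s)\<bar> < \<delta>} z)"
proof (cases "0 < z \<and> z < norm (v j) \<and> edge_dist i j s z < \<delta>")
  case True
  let ?r = "edge_dist i j s z"
  have r: "?r = \<bar>z - (if i = j then s else - s)\<bar>" using True assms(1) by (auto simp: edge_dist_def)
  have x: "param v i s \<in> cl_edge v i" using assms by (intro param_in_cl_edge)
  have "(w (param v j z) - w (param v i s)) * \<nu> i j (param v i s) ?r \<le> L * \<Lambda> * ?r powr (- \<sigma>)"
  proof (cases "?r = 0")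
    \<comment> \<open>At distance zero the kernel is not controlled, but there both values of
      \<open>w\<close> coincide.\<close>
    case True': True
    then have "z = s \<and> i = j" using True assms(1) by (auto simp: edge_dist_def split: if_splits)
    then show ?thesis using \<Lambda> assms(4) by simp
  next
    case False
    then have r0: "0 < ?r" using True assms(1) by (auto simp: edge_dist_def split: if_splits)
    have "(w (param v j z) - w (param v i s)) * \<nu> i j (param v i s) ?r
      \<le> L * ?r * \<nu> i j (param v i s) ?r"
      using le True by (intro mult_right_mono kernel_nonneg[OF x r0]) auto
    also have "\<dots> \<le> L * ?r * (\<Lambda> * ?r powr (- 1 - \<sigma>))"
      using kernel_le[OF x r0] r0 assms(4) by (intro mult_left_mono) auto
    also have "\<dots> = L * \<Lambda> * (?r powr 1 * ?r powr (- 1 - \<sigma>))" using r0 by simp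
    also have "\<dots> = L * \<Lambda> * ?r powr (- \<sigma>)" unfolding powr_add[symmetric] by simp
    finally show ?thesis .
  qed
  then show ?thesis using True r assms(5) by (simp add: integrand_def)
next
  case False
  then show ?thesis using \<Lambda> assms(4,5) by (auto simp: integrand_def)
qed

lemma nn_integral_singular_le:
  assumes "0 \<le> L" "0 < \<delta>" "\<And>z. f z \<le> L * \<Lambda> * (\<bar>z - c\<bar> powr (- \<sigma>) * indicator {z. \<bar>z - c\<bar> < \<delta>} z)"
  shows "(\<integral>\<^sup>+z. ennreal (f z) \<partial>lebesgue) \<le> ennreal (L * (2 * \<Lambda> / (1 - \<sigma>)) * \<delta> powr (1 - \<sigma>))"
proof -
  let ?g = "\<lambda>z. \<bar>z - c\<bar> powr (- \<sigma>) * indicator {z. \<bar>z - c\<bar> < \<delta>} z"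
  have "?g \<in> borel_measurable borel" by measurable
  then have [measurable]: "?g \<in> borel_measurable lebesgue"
    by (intro measurable_completion) simp
  have "(\<integral>\<^sup>+z. ennreal (f z) \<partial>lebesgue) \<le> (\<integral>\<^sup>+z. ennreal (L * \<Lambda>) * ennreal (?g z) \<partial>lebesgue)"
    using assms \<Lambda> by (intro nn_integral_mono) (auto simp: ennreal_mult[symmetric] intro!: ennreal_leI)
  also have "\<dots> = ennreal (L * \<Lambda>) * (\<integral>\<^sup>+z. ennreal (?g z) \<partial>lebesgue)"
    by (rule nn_integral_cmult) measurable
  also have "\<dots> \<le> ennreal (L * \<Lambda>) * ennreal (2 * \<delta> powr (1 - \<sigma>) / (1 - \<sigma>))"
    using nn_integral_abs_powr_le[OF \<sigma>(2) assms(2)] by (intro mult_left_mono) auto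
  also have "\<dots> = ennreal (L * (2 * \<Lambda> / (1 - \<sigma>)) * \<delta> powr (1 - \<sigma>))"
    using assms \<Lambda> \<sigma> by (subst ennreal_mult[symmetric]) (auto simp: field_simps)
  finally show ?thesis .
qed

lemma ereal_integral_singular_le:
  assumes "0 \<le> L" "0 < \<delta>" "\<And>z. f z \<le> L * \<Lambda> * (\<bar>z - c\<bar> powr (- \<sigma>) * indicator {z. \<bar>z - c\<bar> < \<delta>} z)"
  shows "ereal_integral f \<le> ereal (L * (2 * \<Lambda> / (1 - \<sigma>)) * \<delta> powr (1 - \<sigma>))"
proof -
  have "0 \<le> L * (2 * \<Lambda> / (1 - \<sigma>)) * \<delta> powr (1 - \<sigma>)" using assms(1) \<Lambda> \<sigma> by simp
  then show ?thesis
    using ereal_integral_le_nn_integral[of f] nn_integral_singular_le[OF assms]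
    by (metis enn2ereal_ennreal less_eq_ennreal.rep_eq order_trans)
qed

text \<open>Multiplied by \<open>\<delta> powr (1 - \<sigma>)\<close>, this bounds the integral of
  distance times kernel over a ball of radius \<delta>; the factor \<open>CARD('n)\<close> sums over
  the edges.\<close>

definition kernel_const :: real where "kernel_const = real CARD('n) * (2 * \<Lambda> / (1 - \<sigma>))"

lemma kernel_const_nonneg: "0 \<le> kernel_const"
  using \<Lambda> \<sigma> by (simp add: kernel_const_def)

lemma nonlocal_ball_le:
  assumes "0 \<le> s" "s \<le> norm (v i)" "0 < \<delta>" "0 \<le> L"
    and "\<And>j z. 0 < z \<Longrightarrow> z < norm (v j) \<Longrightarrow> edge_dist i j s z < \<delta> \<Longrightarrow>
      w (param v j z) - w (param v i s) \<le> L * edge_dist i j s z"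
  shows "nonlocal v \<nu> i (jball v \<delta> (param v i s)) w (param v i s)
     \<le> ereal (L * kernel_const * \<delta> powr (1 - \<sigma>))"
proof -
  have "nonlocal v \<nu> i (jball v \<delta> (param v i s)) w (param v i s)
     \<le> (\<Sum>j\<in>(UNIV::'n set). ereal (L * (2 * \<Lambda> / (1 - \<sigma>)) * \<delta> powr (1 - \<sigma>)))"
    unfolding nonlocal_eq[OF assms(1,2)]
  proof (intro sum_mono ereal_integral_singular_le[OF assms(4,3)])
    fix j z
    show "integrand i j s (\<lambda>r. r < \<delta>) w z \<le> L * \<Lambda> * (\<bar>z - (if i = j then s else - s)\<bar> powr (- \<sigma>)
        * indicator {z. \<bar>z - (if i = j then s else - s)\<bar> < \<delta>} z)"
      by (rule integrand_near_le[OF assms(1,2) assms(5) assms(4) refl])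
  qed
  also have "\<dots> = ereal (L * kernel_const * \<delta> powr (1 - \<sigma>))"
    by (simp add: kernel_const_def sum_ereal)
  finally show ?thesis .
qed

lemma integrand_near_finite:
  assumes "0 \<le> s" "s \<le> norm (v i)" "0 < \<delta>" "w \<in> C1 v"
  shows "(\<integral>\<^sup>+z. ennreal (integrand i j s (\<lambda>r. r < \<delta>) w z) \<partial>lebesgue) < \<infinity>"
proof -
  obtain L where L: "0 \<le> L" "\<And>i j s t. 0 \<le> s \<Longrightarrow> s \<le> norm (v i) \<Longrightarrow> 0 \<le> t \<Longrightarrow> t \<le> norm (v j) \<Longrightarrow>
    \<bar>w (param v j t) - w (param v i s)\<bar> \<le> L * edge_dist i j s t"
    using C1_Lipschitz[OF assms(4)] by blast
  have "integrand i j s (\<lambda>r. r < \<delta>) w z \<le> L * \<Lambda> * (\<bar>z - (if i = j then s else - s)\<bar> powr (- \<sigma>)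
     * indicator {z. \<bar>z - (if i = j then s else - s)\<bar> < \<delta>} z)" for z
    by (rule integrand_near_le[OF assms(1,2) _ L(1) refl]) (use L(2)[of s i _ j] assms in \<open>fastforce simp: abs_le_iff\<close>)
  from nn_integral_singular_le[OF L(1) assms(3) this]
  show ?thesis by (rule le_less_trans) simp
qed

lemma nonlocal_far_less_top:
  assumes "0 \<le> s" "s \<le> norm (v i)" "0 < \<delta>" "u \<in> USC v"
  shows "nonlocal v \<nu> i (jball_compl v \<delta> (param v i s)) u (param v i s) < \<infinity>"
  unfolding nonlocal_eq[OF assms(1,2)]
  using sum_uminus_ereal[of UNIV "\<lambda>j. ereal_integral (integrand i j s (\<lambda>r. \<not> r < \<delta>) u)",
      OF finite ereal_integral_less_top[OF integrand_far_finite[OF assms]]]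
  by blast

lemma nonlocal_far_uminus:
  assumes "0 \<le> s" "s \<le> norm (v i)" "0 < \<delta>" "u \<in> USC v"
  shows "nonlocal v \<nu> i (jball_compl v \<delta> (param v i s)) (\<lambda>x. - u x) (param v i s) =
     - nonlocal v \<nu> i (jball_compl v \<delta> (param v i s)) u (param v i s)"
  unfolding nonlocal_eq[OF assms(1,2)] integrand_uminus
    ereal_integral_uminus[OF integrand_far_finite[OF assms]]
  using sum_uminus_ereal[of UNIV "\<lambda>j. ereal_integral (integrand i j s (\<lambda>r. \<not> r < \<delta>) u)",
      OF finite ereal_integral_less_top[OF integrand_far_finite[OF assms]]]
  by blast

lemma nonlocal_near_less_top:
  assumes "0 \<le> s" "s \<le> norm (v i)" "0 < \<delta>" "w \<in> C1 v"
  shows "nonlocal v \<nu> i (jball v \<delta> (param v i s)) w (param v i s) < \<infinity>"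
  unfolding nonlocal_eq[OF assms(1,2)]
  using sum_uminus_ereal[of UNIV "\<lambda>j. ereal_integral (integrand i j s (\<lambda>r. r < \<delta>) w)",
      OF finite ereal_integral_less_top[OF integrand_near_finite[OF assms]]]
  by blast

lemma nonlocal_near_uminus:
  assumes "0 \<le> s" "s \<le> norm (v i)" "0 < \<delta>" "w \<in> C1 v"
  shows "nonlocal v \<nu> i (jball v \<delta> (param v i s)) (\<lambda>x. - w x) (param v i s) =
     - nonlocal v \<nu> i (jball v \<delta> (param v i s)) w (param v i s)"
  unfolding nonlocal_eq[OF assms(1,2)] integrand_uminus
    ereal_integral_uminus[OF integrand_near_finite[OF assms]]
  using sum_uminus_ereal[of UNIV "\<lambda>j. ereal_integral (integrand i j s (\<lambda>r. r < \<delta>) w)",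
      OF finite ereal_integral_less_top[OF integrand_near_finite[OF assms]]]
  by blast

section \<open>Changing the radius of the ball and moving its centre to the vertex\<close>

lemma integrand_measurable_0:
  assumes "u \<in> USC v" "Measurable.pred borel P"
  shows "integrand i j 0 P u \<in> borel_measurable lebesgue"
proof -
  define U K where "U = (\<lambda>z. u (param v j (z + 0)) * indicator {0<..<norm (v j)} (z + 0))"
    and "K = (\<lambda>r. \<nu> i j 0 r * indicator {0<..} r)"
  have "0 \<in> cl_edge v i" using param_in_cl_edge[of 0 i] by simp
  then have [measurable]: "U \<in> borel_measurable lebesgue" "K \<in> borel_measurable lebesgue"
    using USC_edge_measurable[OF assms(1), of j 0] kernel_section_measurable[of 0 i j]
    by (simp_all add: U_def K_def)
  have "(\<lambda>z. indicator {z. 0 < z \<and> z < norm (v j) \<and> P z} z :: real) \<in> borel_measurable lborel"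
    using assms(2) by measurable
  then have [measurable]: "(\<lambda>z. indicator {z. 0 < z \<and> z < norm (v j) \<and> P z} z :: real) \<in> borel_measurable lebesgue"
    by (rule measurable_completion)
  have "integrand i j 0 P u = (\<lambda>z. (U z - u 0) * K z * indicator {z. 0 < z \<and> z < norm (v j) \<and> P z} z)"
    by (auto simp: integrand_def U_def K_def indicator_def edge_dist_0)
  then show ?thesis by simp
qed

text \<open>Returns from radius \<epsilon> to the given pair \<delta>, \<phi>. Beyond \<delta> both
  sides agree, and between \<epsilon> and \<delta> the touching inequality replaces \<open>u\<close>
  by \<phi>. Inside \<epsilon> the right-hand side contains an additional piece of the integral of
  \<phi>, which may be negative; the last term compensates for it.\<close>

lemma nonlocal_far_le:
  assumes "u \<in> USC v" "\<phi> \<in> C1 v" "0 < \<epsilon>" "\<epsilon> \<le> \<delta>" "0 \<le> L"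
    and le: "\<And>j z. 0 < z \<Longrightarrow> z < norm (v j) \<Longrightarrow> z < \<delta> \<Longrightarrow> u (param v j z) - u 0 \<le> \<phi> (param v j z) - \<phi> 0"
    and L: "\<And>j z. 0 < z \<Longrightarrow> z < norm (v j) \<Longrightarrow> \<bar>\<phi> (param v j z) - \<phi> 0\<bar> \<le> L * z"
  shows "nonlocal v \<nu> i (jball_compl v \<epsilon> 0) u 0 \<le>
    nonlocal v \<nu> i (jball_compl v \<delta> 0) u 0 + nonlocal v \<nu> i (jball v \<delta> 0) \<phi> 0
      + ereal (L * kernel_const * \<epsilon> powr (1 - \<sigma>))"
proof -
  have \<delta>: "0 < \<delta>" using assms by simp
  have \<phi>: "\<phi> \<in> USC v" using assms(2) by (simp add: C1_def)
  define e where "e = (\<lambda>z. L * \<Lambda> * (\<bar>z - 0\<bar> powr (- \<sigma>) * indicator {z. \<bar>z - 0\<bar> < \<epsilon>} z))"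
  have e_le: "e z \<le> L * \<Lambda> * (\<bar>z - 0\<bar> powr (- \<sigma>) * indicator {z. \<bar>z - 0\<bar> < \<epsilon>} z)" for z
    by (simp add: e_def)
  have e0: "0 \<le> e z" for z using assms \<Lambda> by (simp add: e_def)
  have "e \<in> borel_measurable lborel" unfolding e_def by measurable
  then have [measurable]: "e \<in> borel_measurable lebesgue" by (rule measurable_completion)
  have fin_e: "(\<integral>\<^sup>+z. ennreal (e z) \<partial>lebesgue) < \<infinity>"
    using nn_integral_singular_le[OF assms(5,3) e_le] by (rule le_less_trans) simp
  let ?f = "\<lambda>j. integrand i j 0 (\<lambda>r. \<not> r < \<delta>) u" and ?n = "\<lambda>j. integrand i j 0 (\<lambda>r. r < \<delta>) \<phi>"
  have le_j: "ereal_integral (integrand i j 0 (\<lambda>r. \<not> r < \<epsilon>) u) \<le>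
     ereal_integral (?f j) + ereal_integral (?n j) + ereal (L * (2 * \<Lambda> / (1 - \<sigma>)) * \<epsilon> powr (1 - \<sigma>))" for j
  proof -
    have [measurable]: "?f j \<in> borel_measurable lebesgue"
      using \<delta> by (intro integrand_measurable_0[OF assms(1)]) simp_all
    have [measurable]: "?n j \<in> borel_measurable lebesgue"
      by (intro integrand_measurable_0[OF \<phi>]) simp_all
    have fin: "(\<integral>\<^sup>+z. ennreal (?f j z) \<partial>lebesgue) < \<infinity>" "(\<integral>\<^sup>+z. ennreal (?n j z) \<partial>lebesgue) < \<infinity>"
      using integrand_far_finite[of 0 i \<delta> u j] integrand_near_finite[of 0 i \<delta> \<phi> j] \<delta> assms(1,2) by auto
    have pw: "integrand i j 0 (\<lambda>r. \<not> r < \<epsilon>) u z \<le> ?f j z + ?n j z + e z" for z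
    proof (cases "0 < z \<and> z < norm (v j)")
      case z: True
      have x: "0 \<in> cl_edge v i" using param_in_cl_edge[of 0 i] by simp
      have k: "0 \<le> \<nu> i j 0 z" using z by (intro kernel_nonneg[OF x]) simp
      consider "z < \<epsilon>" | "\<epsilon> \<le> z" "z < \<delta>" | "\<delta> \<le> z" using assms(4) by linarith
      then show ?thesis
      proof cases
        case 1
        have "integrand i j 0 (\<lambda>r. r < \<delta>) (\<lambda>x. - \<phi> x) z \<le> L * \<Lambda> * (\<bar>z - (if i = j then 0 else - 0)\<bar> powr (- \<sigma>)
            * indicator {z. \<bar>z - (if i = j then 0 else - 0)\<bar> < \<delta>} z)"
        proof (rule integrand_near_le[OF _ _ _ assms(5) refl])
          show "- \<phi> (param v j z) - - \<phi> (param v i 0) \<le> L * edge_dist i j 0 z"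
            if "0 < z" "z < norm (v j)" for z
            using L[OF that] that by (simp add: edge_dist_0)
        qed simp_all
        also have "\<dots> = e z" using 1 z assms(4) by (simp add: e_def)
        finally have "- ?n j z \<le> e z" by (simp add: integrand_uminus)
        moreover have "integrand i j 0 (\<lambda>r. \<not> r < \<epsilon>) u z = 0" "?f j z = 0"
          using 1 z assms(4) by (auto simp: integrand_def edge_dist_0)
        ultimately show ?thesis by linarith
      next
        case 2
        then have "integrand i j 0 (\<lambda>r. \<not> r < \<epsilon>) u z = (u (param v j z) - u 0) * \<nu> i j 0 z"
          "?n j z = (\<phi> (param v j z) - \<phi> 0) * \<nu> i j 0 z" "?f j z = 0"
          using z by (auto simp: integrand_def edge_dist_0)
        moreover have "(u (param v j z) - u 0) * \<nu> i j 0 z \<le> (\<phi> (param v j z) - \<phi> 0) * \<nu> i j 0 z"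
          using le[of z j] 2 z k by (intro mult_right_mono) auto
        ultimately show ?thesis using e0[of z] by linarith
      next
        case 3
        then have "integrand i j 0 (\<lambda>r. \<not> r < \<epsilon>) u z = ?f j z" "?n j z = 0"
          using z assms(4) by (auto simp: integrand_def edge_dist_0)
        then show ?thesis using e0[of z] by linarith
      qed
    next
      case False
      then have "integrand i j 0 P w z = 0" for P w by (auto simp: integrand_def)
      then show ?thesis using e0[of z] by simp
    qed
    have "ereal_integral (integrand i j 0 (\<lambda>r. \<not> r < \<epsilon>) u) \<le> ereal_integral (\<lambda>z. ?f j z + ?n j z + e z)"
      by (rule ereal_integral_mono) (rule pw)
    also have "\<dots> = ereal_integral (\<lambda>z. ?f j z + ?n j z) + ereal_integral e"
      using fin fin_e by (intro ereal_integral_add) (auto intro!: ereal_integral_add(2))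
    also have "ereal_integral (\<lambda>z. ?f j z + ?n j z) = ereal_integral (?f j) + ereal_integral (?n j)"
      using fin by (intro ereal_integral_add) auto
    finally show ?thesis
      using ereal_integral_singular_le[OF assms(5,3) e_le]
      by (meson add_left_mono order_trans)
  qed
  have "nonlocal v \<nu> i (jball_compl v \<epsilon> 0) u 0 \<le> (\<Sum>j\<in>UNIV. ereal_integral (?f j) + ereal_integral (?n j)
      + ereal (L * (2 * \<Lambda> / (1 - \<sigma>)) * \<epsilon> powr (1 - \<sigma>)))"
    using nonlocal_eq(2)[of 0 i \<epsilon> u] le_j by (simp add: sum_mono)
  also have "\<dots> = nonlocal v \<nu> i (jball_compl v \<delta> 0) u 0 + nonlocal v \<nu> i (jball v \<delta> 0) \<phi> 0
      + ereal (L * kernel_const * \<epsilon> powr (1 - \<sigma>))"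
    using nonlocal_eq(2)[of 0 i \<delta> u] nonlocal_eq(1)[of 0 i \<delta> \<phi>]
    by (simp add: sum.distrib sum_ereal kernel_const_def mult_ac)
  finally show ?thesis .
qed


text \<open>The kernel is merely measurable in \<open>r\<close>, so each edge is reparametrised by the distance \<open>r\<close> to the
  moving point: then \<open>r\<close> stays fixed in the kernel, and the translations act on \<open>u\<close>, which is upper
  semicontinuous.\<close>

lemma nonlocal_far_limsup:
  assumes u: "u \<in> USC v" and \<delta>: "0 < \<delta>"
    and s: "\<And>k. 0 \<le> s k" "\<And>k. s k \<le> norm (v i)" "s \<longlonglongrightarrow> 0"
    and us: "(\<lambda>k. u (param v i (s k))) \<longlonglongrightarrow> u 0"
    and c: "nonlocal v \<nu> i (jball_compl v \<delta> 0) u 0 < c"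
  shows "\<forall>\<^sub>F k in sequentially.
    nonlocal v \<nu> i (jball_compl v \<delta> (param v i (s k))) u (param v i (s k)) < c"
proof -
  define x where "x = (\<lambda>k. param v i (s k))"
  \<comment> \<open>The point of edge \<open>j\<close> at distance \<open>r\<close> from
    \<open>x k\<close> has parameter \<open>r + d k j\<close>.\<close>
  define d where "d = (\<lambda>k j. if i = j then s k else - s k)"
  define F where "F = (\<lambda>k j r. (u (param v j (r + d k j)) - u (x k)) * \<nu> i j (x k) r
      * indicator {r. 0 < r + d k j \<and> r + d k j < norm (v j) \<and> \<delta> \<le> r} r)"
  define F' where "F' = (\<lambda>j. integrand i j 0 (\<lambda>r. \<not> r < \<delta>) u)"
  have x: "x k \<in> cl_edge v i" "0 \<in> cl_edge v i" for k
    using s param_in_cl_edge[of "s k" i] param_in_cl_edge[of 0 i] by (auto simp: x_def)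
  have d_le: "\<bar>d k j\<bar> \<le> s k" for k j using s(1) by (simp add: d_def)
  have d0: "(\<lambda>k. d k j) \<longlonglongrightarrow> 0" for j
    using s(3) tendsto_minus[OF s(3)] by (cases "i = j") (auto simp: d_def)

  \<comment> \<open>Once \<open>s k < \<delta>\<close>, the far part of edge \<open>i\<close> lies
    wholly on the outer side of \<open>x k\<close>, so one translation per edge suffices.\<close>
  have shift: "integrand i j (s k) (\<lambda>r. \<not> r < \<delta>) u = (\<lambda>z. F k j (z - d k j))" if "s k < \<delta>" for k j
  proof
    fix z
    have 1: "edge_dist i j (s k) z = z - d k j" if "0 < z" "\<not> edge_dist i j (s k) z < \<delta>"
      using that \<open>s k < \<delta>\<close> s(1)[of k] by (auto simp: edge_dist_def d_def split: if_splits)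
    have 2: "edge_dist i j (s k) z = z - d k j" if "0 < z" "\<delta> \<le> z - d k j"
      using that \<delta> by (auto simp: edge_dist_def d_def split: if_splits)
    show "integrand i j (s k) (\<lambda>r. \<not> r < \<delta>) u z = F k j (z - d k j)"
    proof (cases "0 < z \<and> z < norm (v j) \<and> \<not> edge_dist i j (s k) z < \<delta>")
      case True
      with 1 show ?thesis by (simp add: integrand_def F_def x_def)
    next
      case False
      with 2 have "\<not> (0 < z \<and> z < norm (v j) \<and> \<delta> \<le> z - d k j)" by auto
      with False show ?thesis by (simp add: integrand_def F_def)
    qed
  qed

  have [measurable]: "F k j \<in> borel_measurable lebesgue" for k j
  proof -
    define U K I where "U = (\<lambda>z. u (param v j (z + d k j)) * indicator {0<..<norm (v j)} (z + d k j))"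
      and "K = (\<lambda>r. \<nu> i j (x k) r * indicator {0<..} r)"
      and "I = (\<lambda>r. indicator {r. 0 < r + d k j \<and> r + d k j < norm (v j) \<and> \<delta> \<le> r} r :: real)"
    have "I \<in> borel_measurable lborel" unfolding I_def by measurable
    then have "I \<in> borel_measurable lebesgue" by (rule measurable_completion)
    moreover have "U \<in> borel_measurable lebesgue" "K \<in> borel_measurable lebesgue"
      using USC_edge_measurable[OF u, of j "d k j"] kernel_section_measurable[OF x(1), of j k]
      by (simp_all add: U_def K_def)
    ultimately have "(\<lambda>r. (U r - u (x k)) * K r * I r) \<in> borel_measurable lebesgue" by simp
    also have "(\<lambda>r. (U r - u (x k)) * K r * I r) = F k j"
      using \<delta> by (auto simp: U_def K_def I_def F_def indicator_def)
    finally show ?thesis .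
  qed
  have F'_meas[measurable]: "F' j \<in> borel_measurable lebesgue" for j
    unfolding F'_def by (intro integrand_measurable_0[OF u]) simp

  obtain M where M: "\<And>i s. 0 \<le> s \<Longrightarrow> s \<le> norm (v i) \<Longrightarrow> u (param v i s) \<le> M"
    using USC_bounded_above[OF u] by blast
  obtain M' where M': "\<And>k. \<bar>u (x k)\<bar> \<le> M'"
    using convergent_imp_Bseq[OF convergentI[OF us]] unfolding Bseq_def x_def by auto
  have M'0: "\<bar>u 0\<bar> \<le> M'"
    by (rule LIMSEQ_le_const2[OF tendsto_rabs[OF us[folded x_def]]]) (use M' x_def in auto)
  define C where "C = (M + M') * (\<Lambda> * \<delta> powr (- 1 - \<sigma>))"
  define R where "R = 2 * (\<Sum>j\<in>UNIV. norm (v j))"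
  have R: "norm (v j) + norm (v i) \<le> R" for j
    using member_le_sum[of j UNIV "\<lambda>j. norm (v j)"] member_le_sum[of i UNIV "\<lambda>j. norm (v j)"]
    by (simp add: R_def)
  have MM: "0 \<le> M + M'" using M[of 0 i] M'0 by simp
  have C: "0 \<le> C" using MM \<Lambda> by (simp add: C_def)
  have F_le: "F k j r \<le> C * indicator {0..R} r" for k j r
  proof (cases "0 < r + d k j \<and> r + d k j < norm (v j) \<and> \<delta> \<le> r")
    case True
    then have r: "0 < r" "r \<le> R" using \<delta> d_le[of k j] s(2)[of k] R[of j] by auto
    have "\<nu> i j (x k) r \<le> \<Lambda> * r powr (- 1 - \<sigma>)" using kernel_le[OF x(1) r(1)] .
    also have "\<dots> \<le> \<Lambda> * \<delta> powr (- 1 - \<sigma>)"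
      using True r \<Lambda> \<sigma> \<delta> by (intro mult_left_mono powr_mono2') auto
    finally have "(u (param v j (r + d k j)) - u (x k)) * \<nu> i j (x k) r \<le> C"
      unfolding C_def using kernel_nonneg[OF x(1) r(1)] M[of "r + d k j" j] M'[of k] True MM
      by (intro mult_mono) auto
    then show ?thesis using True r by (simp add: F_def)
  next
    case False
    then show ?thesis using C by (simp add: F_def)
  qed
  have F'_le: "F' j r \<le> C * indicator {0..R} r" for j r
  proof -
    have "F' j r \<le> (M - u 0) * (\<Lambda> * \<delta> powr (- 1 - \<sigma>)) * indicator {0..norm (v j)} r"
      unfolding F'_def using integrand_far_le[of 0 i \<delta> u M j r] \<delta> M by simp
    also have "\<dots> \<le> C * indicator {0..R} r"
    proof (intro mult_mono)
      show "(M - u 0) * (\<Lambda> * \<delta> powr (- 1 - \<sigma>)) \<le> C"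
        unfolding C_def using M'0 \<Lambda> by (intro mult_right_mono) auto
      show "(indicator {0..norm (v j)} r :: real) \<le> indicator {0..R} r"
        using R[of j] norm_ge_zero[of "v i"] by (auto simp: indicator_def simp del: norm_ge_zero)
    qed (use C in auto)
    finally show ?thesis .
  qed
  have fin: "(\<integral>\<^sup>+z. ennreal (f z) \<partial>lebesgue) < \<infinity>" if "\<And>z. f z \<le> C * indicator {0..R} z" for f
    by (rule le_less_trans[OF nn_integral_mono nn_integral_const_interval])
       (use that in \<open>auto intro: ennreal_leI\<close>)

  \<comment> \<open>At \<open>r = norm (v j)\<close> the moving domain may contain \<open>r\<close>
    for every \<open>k\<close> while \<open>F'\<close> vanishes there; these finitely many
    \<open>r\<close> are excluded. The condition \<open>\<delta> \<le> r\<close> does not move and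
    causes no such exception.\<close>
  have lim: "\<forall>\<^sub>F k in sequentially. F k j r < c" if r: "r \<noteq> norm (v j)" and "F' j r < c" for j r c
  proof -
    consider "r < \<delta>" | "\<delta> \<le> r" "r < norm (v j)" | "norm (v j) < r" using r by linarith
    then show ?thesis
    proof cases
      case 1
      have "F' j r = 0" using 1 by (auto simp: F'_def integrand_def edge_dist_0)
      then show ?thesis using 1 \<open>F' j r < c\<close> by (auto simp: F_def)
    next
      case 3
      have "F' j r = 0" using 3 by (auto simp: F'_def integrand_def)
      moreover have "\<forall>\<^sub>F k in sequentially. norm (v j) - r < d k j"
        using 3 by (intro order_tendstoD(1)[OF d0]) simp
      ultimately show ?thesis
        using \<open>F' j r < c\<close> by (auto simp: F_def elim!: eventually_mono)
    next
      case 2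
      have r0: "0 < r" using 2 \<delta> by simp
      have F'_r: "F' j r = (u (param v j r) - u 0) * \<nu> i j 0 r"
        using 2 r0 by (simp add: F'_def integrand_def edge_dist_0)
      have "(\<lambda>k. r + d k j) \<longlonglongrightarrow> r + 0" by (intro tendsto_intros d0)
      then have rd: "(\<lambda>k. r + d k j) \<longlonglongrightarrow> r" by simp
      have ev: "\<forall>\<^sub>F k in sequentially. 0 < r + d k j" "\<forall>\<^sub>F k in sequentially. r + d k j < norm (v j)"
        using order_tendstoD[OF rd] r0 2 by auto
      have kern: "(\<lambda>k. \<nu> i j (x k) r) \<longlonglongrightarrow> \<nu> i j 0 r"
      proof (rule LIM_zero_cancel, rule Lim_null_comparison)
        show "\<forall>\<^sub>F k in sequentially. norm (\<nu> i j (x k) r - \<nu> i j 0 r) \<le> \<Lambda> * r powr (- 1 - \<sigma>) * s k"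
          using kernel_Lipschitz[OF x(1) x(2) r0, of j] s(1) by (simp add: x_def norm_param)
        show "(\<lambda>k. \<Lambda> * r powr (- 1 - \<sigma>) * s k) \<longlonglongrightarrow> 0"
          using tendsto_mult_right_zero[OF s(3)] by simp
      qed
      \<comment> \<open>Semicontinuity bounds \<open>u\<close> at the translated points from above;
        the term \<open>- u (x k)\<close> has the opposite sign and is controlled by the convergence
        assumed in \<open>us\<close>.\<close>
      have a: "\<forall>\<^sub>F k in sequentially. u (param v j (r + d k j)) - u (x k) < (u (param v j r) - u 0) + e"
        if "e > 0" for e
      proof -
        have "usc_on {0..norm (v j)} (u \<circ> param v j)" using u by (simp add: USC_def)
        then have "\<forall>\<^sub>F k in sequentially. (u \<circ> param v j) (r + d k j) < (u \<circ> param v j) r + e / 2"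
        proof (rule usc_on_sequentially[OF _ _ _ rd])
          show "\<forall>\<^sub>F k in sequentially. r + d k j \<in> {0..norm (v j)}"
            using eventually_conj[OF ev] by eventually_elim auto
        qed (use 2 r0 that in auto)
        moreover have "\<forall>\<^sub>F k in sequentially. u 0 - e / 2 < u (x k)"
          using order_tendstoD(1)[OF us[folded x_def], of "u 0 - e / 2"] that by (simp add: x_def)
        ultimately show ?thesis by eventually_elim auto
      qed
      have "\<forall>\<^sub>F k in sequentially. (u (param v j (r + d k j)) - u (x k)) * \<nu> i j (x k) r < c"
        by (rule eventually_mult_less[OF kern kernel_nonneg[OF x(1) r0] a])
           (use \<open>F' j r < c\<close>[unfolded F'_r] in auto)
      with ev show ?thesis
        by eventually_elim (use 2 in \<open>simp add: F_def\<close>)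
    qed
  qed

  have sumF: "(\<Sum>j\<in>UNIV. ereal_integral (F k j)) = ereal_integral (\<lambda>r. \<Sum>j\<in>UNIV. F k j r)" for k
    using ereal_integral_sum[of UNIV "F k"] fin[OF F_le] by simp
  have sumF': "(\<Sum>j\<in>UNIV. ereal_integral (F' j)) = ereal_integral (\<lambda>r. \<Sum>j\<in>UNIV. F' j r)"
    using ereal_integral_sum[of UNIV F'] fin[OF F'_le] by simp
  have "\<forall>\<^sub>F k in sequentially. ereal_integral (\<lambda>r. \<Sum>j\<in>UNIV. F k j r) < c"
  proof (rule reverse_Fatou_ereal_integral)
    let ?g = "\<lambda>r. (real CARD('n) * C) * indicator {0..R} r"
    show "(\<Sum>j\<in>UNIV. F k j r) \<le> ?g r" for k r
      using sum_mono[of UNIV "\<lambda>j. F k j r" "\<lambda>_. C * indicator {0..R} r"] F_le by simp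
    show "(\<Sum>j\<in>UNIV. F' j r) \<le> ?g r" for r
      using sum_mono[of UNIV "\<lambda>j. F' j r" "\<lambda>_. C * indicator {0..R} r"] F'_le by simp
    show "0 \<le> ?g r" for r using C by simp
    have "?g \<in> borel_measurable lborel" by measurable
    then show "?g \<in> borel_measurable lebesgue" by (rule measurable_completion)
    show "(\<integral>\<^sup>+z. ennreal (?g z) \<partial>lebesgue) < \<infinity>" by (rule nn_integral_const_interval)
    have "range (\<lambda>j. norm (v j)) \<in> null_sets lebesgue"
      by (intro null_sets_completionI finite_imp_null_set_lborel) simp
    from AE_not_in[OF this]
    show "AE r in lebesgue. \<forall>c>\<Sum>j\<in>UNIV. F' j r. \<forall>\<^sub>F k in sequentially. (\<Sum>j\<in>UNIV. F k j r) < c"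
    proof eventually_elim
      case (elim r)
      then show ?case by (auto intro!: eventually_sum_less lim)
    qed
    show "ereal_integral (\<lambda>r. \<Sum>j\<in>UNIV. F' j r) < c"
      using c nonlocal_eq(2)[of 0 i \<delta> u] unfolding sumF'[symmetric] by (simp add: F'_def)
  qed measurable
  moreover have "\<forall>\<^sub>F k in sequentially. s k < \<delta>" using s(3) \<delta> by (rule order_tendstoD)
  ultimately show ?thesis
  proof eventually_elim
    case (elim k)
    then show ?case
      unfolding nonlocal_eq[OF s(1,2)] shift[OF elim(2)]
      by (simp add: ereal_integral_translate sumF)
  qed
qed

text \<open>Negation passes through an extended-real sum only away from \<infinity> - \<infinity>.
  Here the near term of a \<open>C1\<close> function is finite and the far term of
  \<open>- u\<close> lies below \<infinity>, since \<open>- u\<close> is upper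
  semicontinuous.\<close>

lemma G_uminus:
  assumes "0 \<le> s" "s \<le> norm (v i)" "0 < \<delta>" "u \<in> LSC v" "\<phi> \<in> C1 v"
  shows "G v lam \<nu> (\<lambda>i x p. - K i x (- p)) i \<delta> (\<lambda>x. - u x) (\<lambda>x. - \<phi> x) (- p) (param v i s)
    = - G v lam \<nu> K i \<delta> u \<phi> p (param v i s)"
proof -
  let ?x = "param v i s"
  define I J where "I = nonlocal v \<nu> i (jball_compl v \<delta> ?x) (\<lambda>x. - u x) ?x"
    and "J = nonlocal v \<nu> i (jball v \<delta> ?x) (\<lambda>x. - \<phi> x) ?x"
  have u: "(\<lambda>x. - u x) \<in> USC v"
    using assms(4) by (simp add: USC_def LSC_def lsc_on_iff_usc_on o_def)
  have \<phi>: "(\<lambda>x. - \<phi> x) \<in> C1 v" by (rule C1_uminus[OF assms(5)])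
  have eq: "nonlocal v \<nu> i (jball_compl v \<delta> ?x) u ?x = - I" "nonlocal v \<nu> i (jball v \<delta> ?x) \<phi> ?x = - J"
    using nonlocal_far_uminus[OF assms(1-3) u] nonlocal_near_uminus[OF assms(1-3) \<phi>]
    by (simp_all add: I_def J_def)
  have "I < \<infinity>" "J < \<infinity>"
    unfolding I_def J_def by (intro nonlocal_far_less_top nonlocal_near_less_top assms u \<phi>)+
  moreover have "- J < \<infinity>"
    using nonlocal_near_less_top[OF assms(1-3,5)] eq by simp
  ultimately show ?thesis
    unfolding G_def eq I_def[symmetric] J_def[symmetric]
    by (cases I; cases J) auto
qed

section \<open>Test slopes at the vertex\<close>


text \<open>The part of the subsolution condition that is used, without the conditions at the outer endpoints.
  The Hamiltonian is an arbitrary \<open>K\<close>, because supersolutions enter through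
  \<open>-u\<close> and \<open>K\<^sub>i(x,p) = -H\<^sub>i(x,-p)\<close>, which is concave.\<close>

definition kirchhoff_sub :: "real \<Rightarrow> ('n \<Rightarrow> 'a \<Rightarrow> real \<Rightarrow> real) \<Rightarrow> real \<Rightarrow> ('a \<Rightarrow> real) \<Rightarrow> bool" where
  "kirchhoff_sub lam K B u \<longleftrightarrow> u \<in> USC v \<and> (\<forall>\<delta>>0. \<forall>\<phi>\<in>C1 v.
     (\<forall>i s. 0 < s \<longrightarrow> s < norm (v i) \<longrightarrow>
        max_point_on (jball v \<delta> (param v i s)) (\<lambda>z. u z - \<phi> z) (param v i s) \<longrightarrow>
        G v lam \<nu> K i \<delta> u \<phi> (edge_deriv v \<phi> i (param v i s)) (param v i s) \<le> 0) \<and>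
     (max_point_on (jball v \<delta> 0) (\<lambda>z. u z - \<phi> z) 0 \<longrightarrow>
        (\<exists>i. G v lam \<nu> K i \<delta> u \<phi> (edge_deriv v \<phi> i 0) 0 \<le> 0) \<or>
        (\<Sum>i\<in>UNIV. - edge_deriv v \<phi> i 0) - B \<le> 0))"

lemma kirchhoff_sub_edge:
  assumes "kirchhoff_sub lam K B u" "0 < \<delta>" "\<phi> \<in> C1 v" "0 < s" "s < norm (v i)"
    "max_point_on (jball v \<delta> (param v i s)) (\<lambda>z. u z - \<phi> z) (param v i s)"
  shows "G v lam \<nu> K i \<delta> u \<phi> (edge_deriv v \<phi> i (param v i s)) (param v i s) \<le> 0"
  using assms unfolding kirchhoff_sub_def by blast

lemma kirchhoff_sub_vertex:
  assumes "kirchhoff_sub lam K B u" "0 < \<delta>" "\<phi> \<in> C1 v"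
    "max_point_on (jball v \<delta> 0) (\<lambda>z. u z - \<phi> z) 0"
  shows "(\<exists>i. G v lam \<nu> K i \<delta> u \<phi> (edge_deriv v \<phi> i 0) 0 \<le> 0) \<or>
    (\<Sum>i\<in>UNIV. - edge_deriv v \<phi> i 0) - B \<le> 0"
  using assms unfolding kirchhoff_sub_def by blast

text \<open>The part of \<open>G\<close> at \<open>O\<close> that is independent of the slope: for
  fixed \<delta> and \<phi>, every comparison of slopes reduces to comparing Hamiltonians against
  this constant. It is extended-valued because the far term may diverge.\<close>

definition G0 :: "real \<Rightarrow> 'n \<Rightarrow> real \<Rightarrow> ('a \<Rightarrow> real) \<Rightarrow> ('a \<Rightarrow> real) \<Rightarrow> ereal" where
  "G0 lam i \<delta> u \<phi> = ereal (lam * u 0) - nonlocal v \<nu> i (jball_compl v \<delta> 0) u 0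
       - nonlocal v \<nu> i (jball v \<delta> 0) \<phi> 0"

lemma G_eq_G0: "G v lam \<nu> K i \<delta> u \<phi> p 0 = G0 lam i \<delta> u \<phi> + ereal (K i 0 p)"
  by (simp add: G_def G0_def)

text \<open>The infimum of these slopes is the upper Dini derivative of \<open>u\<close> along the
  edge at \<open>O\<close>. A predicate is used since that infimum may be -\<infinity>.\<close>

definition slope_bound :: "('a \<Rightarrow> real) \<Rightarrow> 'n \<Rightarrow> real \<Rightarrow> bool" where
  "slope_bound u i p \<longleftrightarrow> (\<exists>r>0. \<forall>z. 0 < z \<longrightarrow> z < r \<longrightarrow> z < norm (v i) \<longrightarrow> u (param v i z) \<le> u 0 + p * z)"

lemma slope_bound_mono:
  assumes "slope_bound u i p" "p \<le> q"
  shows "slope_bound u i q"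
proof -
  obtain r where r: "r > 0" "\<And>z. 0 < z \<Longrightarrow> z < r \<Longrightarrow> z < norm (v i) \<Longrightarrow> u (param v i z) \<le> u 0 + p * z"
    using assms(1) by (auto simp: slope_bound_def)
  have "u (param v i z) \<le> u 0 + q * z" if "0 < z" "z < r" "z < norm (v i)" for z
    using r(2)[OF that] mult_right_mono[OF assms(2), of z] that by linarith
  with r(1) show ?thesis by (auto simp: slope_bound_def)
qed

lemma max_point_at_0:
  assumes "max_point_on (jball v \<delta> 0) (\<lambda>z. u z - \<phi> z) 0" "0 \<le> z" "z \<le> norm (v j)" "z < \<delta>"
  shows "u (param v j z) - u 0 \<le> \<phi> (param v j z) - \<phi> 0"
proof -
  have "edge_dist j j 0 z = z" using assms(2) by (simp add: edge_dist_def)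
  then have "param v j z \<in> jball v \<delta> 0"
    using param_in_jball_iff(1)[of 0 j z j \<delta>] assms by simp
  then show ?thesis using assms(1) by (force simp: max_point_on_def)
qed

text \<open>Consequently the critical slope is below \<infinity> and does not exceed the derivative
  of a function touching \<open>u\<close> from above at \<open>O\<close>.\<close>

lemma slope_bound_deriv:
  assumes \<phi>: "\<phi> \<in> C1 v" and "0 < \<delta>" "max_point_on (jball v \<delta> 0) (\<lambda>z. u z - \<phi> z) 0"
    and p: "edge_deriv v \<phi> i 0 < p"
  shows "slope_bound u i p"
proof -
  let ?f = "\<phi> \<circ> param v i"
  have "(?f has_real_derivative edge_deriv v \<phi> i 0) (at 0 within {0..norm (v i)})"
    using C1_derivative[OF \<phi>, of 0 i] by simp
  then have "((\<lambda>z. (?f z - ?f 0) / (z - 0)) \<longlongrightarrow> edge_deriv v \<phi> i 0) (at 0 within {0..norm (v i)})"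
    by (simp add: has_field_derivative_iff)
  then have "\<forall>\<^sub>F z in at 0 within {0..norm (v i)}. (?f z - ?f 0) / (z - 0) < p"
    using p by (rule order_tendstoD)
  then obtain r where r: "r > 0"
    "\<And>z. z \<in> {0..norm (v i)} \<Longrightarrow> 0 < dist z 0 \<Longrightarrow> dist z 0 < r \<Longrightarrow> (?f z - ?f 0) / (z - 0) < p"
    by (auto simp: eventually_at)
  have "u (param v i z) \<le> u 0 + p * z" if "0 < z" "z < min r \<delta>" "z < norm (v i)" for z
  proof -
    have "(\<phi> (param v i z) - \<phi> 0) / z < p" using r(2)[of z] that by simp
    then have "\<phi> (param v i z) - \<phi> 0 < p * z" using that(1) by (simp add: pos_divide_less_eq)
    then show ?thesis using max_point_at_0[OF assms(3), of z i] that by simp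
  qed
  then show ?thesis
    using r(1) assms(2) unfolding slope_bound_def by (intro exI[of _ "min r \<delta>"]) auto
qed

lemma small_radius:
  assumes "0 < \<eta>" "0 \<le> C" "0 < r"
  obtains e where "0 < e" "e \<le> r" "C * e powr (1 - \<sigma>) < \<eta>"
proof
  define e0 where "e0 = (\<eta> / (C + 1)) powr (1 / (1 - \<sigma>))"
  have e0: "0 < e0" using assms by (simp add: e0_def)
  show "0 < min r e0" "min r e0 \<le> r" using e0 assms by auto
  have "(min r e0) powr (1 - \<sigma>) \<le> e0 powr (1 - \<sigma>)"
    using \<sigma> assms e0 by (intro powr_mono2) auto
  also have "\<dots> = \<eta> / (C + 1)" using \<sigma> assms by (simp add: e0_def powr_powr)
  finally have "C * (min r e0) powr (1 - \<sigma>) \<le> C * (\<eta> / (C + 1))" using assms by (intro mult_left_mono)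
  also have "\<dots> < \<eta>" using assms by (simp add: field_simps)
  finally show "C * (min r e0) powr (1 - \<sigma>) < \<eta>" .
qed

lemma C1_Lipschitz_at_0:
  assumes "\<phi> \<in> C1 v"
  obtains L where "0 \<le> L" "\<And>j z. 0 \<le> z \<Longrightarrow> z \<le> norm (v j) \<Longrightarrow> \<bar>\<phi> (param v j z) - \<phi> 0\<bar> \<le> L * z"
proof -
  obtain L where L: "0 \<le> L" "\<And>i j s t. 0 \<le> s \<Longrightarrow> s \<le> norm (v i) \<Longrightarrow> 0 \<le> t \<Longrightarrow> t \<le> norm (v j) \<Longrightarrow>
    \<bar>\<phi> (param v j t) - \<phi> (param v i s)\<bar> \<le> L * edge_dist i j s t"
    using C1_Lipschitz[OF assms] by blast
  have "\<bar>\<phi> (param v j z) - \<phi> 0\<bar> \<le> L * z" if "0 \<le> z" "z \<le> norm (v j)" for j z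
    using L(2)[of 0 j z j] that by (simp add: edge_dist_def)
  with L(1) show ?thesis using that by blast
qed

text \<open>The test is made with the piecewise linear function of slopes \<open>p i\<close> on a
  ball of small radius \<open>d\<close>. Replacing its near term and the radius by \<phi> and
  \<delta> costs at most \<open>(L + P) * kernel_const * d powr (1 - \<sigma>)\<close>:
  \<open>L\<close> from the change of radius, \<open>P\<close> from the linear function. If all
  alternatives failed, \<open>d\<close> could be chosen so that this stays below the gap.\<close>

lemma kirchhoff_sub_slopes:
  assumes sub: "kirchhoff_sub lam K B u"
    and \<phi>: "\<phi> \<in> C1 v" "0 < \<delta>" "max_point_on (jball v \<delta> 0) (\<lambda>z. u z - \<phi> z) 0"
    and p: "\<And>i. slope_bound u i (p i)"
  shows "(\<exists>i. G0 lam i \<delta> u \<phi> + ereal (K i 0 (p i)) \<le> 0) \<or> (\<Sum>i\<in>UNIV. - p i) - B \<le> 0"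
proof (rule ccontr)
  assume "\<not> ?thesis"
  then have pos: "\<And>i. 0 < G0 lam i \<delta> u \<phi> + ereal (K i 0 (p i))" and B: "0 < (\<Sum>i\<in>UNIV. - p i) - B"
    by (auto simp: not_le)
  have u: "u \<in> USC v" using sub by (simp add: kirchhoff_sub_def)
  \<comment> \<open>\<open>G0\<close> may be \<infinity>, so a real gap is picked on each edge
    before the smallest one is taken.\<close>
  have "\<exists>e>0. ereal e < G0 lam i \<delta> u \<phi> + ereal (K i 0 (p i))" for i
    using ereal_dense2[OF pos[of i]] by (auto simp: zero_ereal_def)
  then obtain e where e: "\<And>i. 0 < e i" "\<And>i. ereal (e i) < G0 lam i \<delta> u \<phi> + ereal (K i 0 (p i))"
    by metis
  define \<eta> where "\<eta> = Min (range e)"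
  have \<eta>: "0 < \<eta>" "\<And>i. \<eta> \<le> e i" using e by (auto simp: \<eta>_def)
  from p obtain r where r: "\<And>i. 0 < r i"
    "\<And>i z. 0 < z \<Longrightarrow> z < r i \<Longrightarrow> z < norm (v i) \<Longrightarrow> u (param v i z) \<le> u 0 + p i * z"
    unfolding slope_bound_def by metis
  define R where "R = Min (insert \<delta> (range (\<lambda>i. min (r i) (norm (v i)))))"
  have R: "0 < R" "R \<le> \<delta>" "\<And>i. R \<le> r i" "\<And>i. R \<le> norm (v i)"
  proof -
    have f: "finite (insert \<delta> (range (\<lambda>i. min (r i) (norm (v i)))))" by simp
    show "0 < R" unfolding R_def using r(1) \<phi>(2) nz by auto
    show "R \<le> \<delta>" unfolding R_def by simp
    have "R \<le> min (r i) (norm (v i))" for i unfolding R_def by (rule Min_le[OF f]) auto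
    then show "R \<le> r i" "R \<le> norm (v i)" for i by (meson min.boundedE)+
  qed
  obtain L where L: "0 \<le> L" "\<And>j z. 0 \<le> z \<Longrightarrow> z \<le> norm (v j) \<Longrightarrow> \<bar>\<phi> (param v j z) - \<phi> 0\<bar> \<le> L * z"
    using C1_Lipschitz_at_0[OF \<phi>(1)] by blast
  define P where "P = (\<Sum>i\<in>UNIV. \<bar>p i\<bar>)"
  have P: "\<bar>p i\<bar> \<le> P" for i unfolding P_def by (rule member_le_sum) auto
  have P0: "0 \<le> P" unfolding P_def by (rule sum_nonneg) auto
  obtain d where d: "0 < d" "d \<le> R" "(L + P) * kernel_const * d powr (1 - \<sigma>) < \<eta>"
    using small_radius[of \<eta> "(L + P) * kernel_const" R] \<eta>(1) R(1) L(1) P0 kernel_const_nonneg by auto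
  obtain \<psi> where \<psi>: "\<And>i s. 0 \<le> s \<Longrightarrow> \<psi> (param v i s) = u 0 + p i * s"
    by (rule glue_edge_functions[of "\<lambda>i s. u 0 + p i * s" "u 0"]) auto
  have der: "((\<lambda>s. u 0 + p i * s) has_real_derivative p i) (at s)" for i s
    by (auto intro!: derivative_eq_intros)
  have D: "\<psi> \<in> C1 v" "edge_deriv v \<psi> i 0 = p i" for i
    using C1I(1)[of \<psi>, OF \<psi> der] C1I(2)[of \<psi>, OF \<psi> der, of 0 i] by simp_all
  have \<psi>0: "\<psi> 0 = u 0" using \<psi>[of 0] by simp
  have "max_point_on (jball v d 0) (\<lambda>z. u z - \<psi> z) 0"
    unfolding max_point_on_def
  proof
    fix x assume x: "x \<in> jball v d 0"
    then obtain j t where t: "0 \<le> t" "t \<le> norm (v j)" "x = param v j t"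
      by (auto simp: jball_def elim: junction_cases)
    have "edge_dist j j 0 t < d" using x t param_in_jball_iff(1)[of 0 j t j d] by simp
    then have "t < d" using t by (simp add: edge_dist_def)
    then show "u x - \<psi> x \<le> u 0 - \<psi> 0"
      using r(2)[of t j] R(3,4)[of j] d(2) t \<psi>[of t j] \<psi>0 by (cases "t = 0") auto
  qed
  then have "(\<exists>i. G v lam \<nu> K i d u \<psi> (p i) 0 \<le> 0) \<or> (\<Sum>i\<in>UNIV. - p i) - B \<le> 0"
    using kirchhoff_sub_vertex[OF sub d(1) D(1)] by (simp add: D(2))
  then obtain i where i: "G v lam \<nu> K i d u \<psi> (p i) 0 \<le> 0" using B by auto
  define N I I' J where "N = nonlocal v \<nu> i (jball_compl v d 0) u 0"
    and "I = nonlocal v \<nu> i (jball_compl v \<delta> 0) u 0"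
    and "I' = nonlocal v \<nu> i (jball v \<delta> 0) \<phi> 0" and "J = nonlocal v \<nu> i (jball v d 0) \<psi> 0"
  have N: "N \<le> I + I' + ereal (L * kernel_const * d powr (1 - \<sigma>))"
    unfolding N_def I_def I'_def
    by (rule nonlocal_far_le[OF u \<phi>(1) d(1) _ L(1)])
       (use d R(2) L(2) max_point_at_0[OF \<phi>(3)] in auto)
  have J: "J \<le> ereal (P * kernel_const * d powr (1 - \<sigma>))"
  proof -
    have "\<psi> (param v j z) - \<psi> (param v i 0) \<le> P * edge_dist i j 0 z" if "0 < z" for j z
      using P[of j] \<psi>[of z j] \<psi>0 that mult_right_mono[of "p j" P z] by (simp add: edge_dist_0)
    then show ?thesis
      using nonlocal_ball_le[of 0 i d P \<psi>] d P0 by (simp add: J_def)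
  qed
  have I: "I < \<infinity>" "I' < \<infinity>"
    using nonlocal_far_less_top[of 0 i \<delta> u] nonlocal_near_less_top[of 0 i \<delta> \<phi>] \<phi> u
    by (simp_all add: I_def I'_def)
  have "ereal \<eta> < ereal (lam * u 0) - I - I' + ereal (K i 0 (p i))"
    using e(2)[of i] \<eta>(2)[of i] unfolding G0_def I_def I'_def by (meson ereal_less_eq(3) le_less_trans)
  moreover have "ereal (lam * u 0) - N - J + ereal (K i 0 (p i)) \<le> 0"
    using i by (simp add: G_def N_def J_def)
  ultimately show False
    using N J I d(3) by (cases I; cases I'; cases N; cases J) (auto simp: algebra_simps)
qed

text \<open>The radius \<open>d\<close> stays fixed while the touching points approach
  \<open>O\<close>, as the limit of the far terms requires. The balls therefore reach across the
  vertex, and the test functions must dominate \<open>u\<close> on all other edges too; there the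
  Lipschitz constant of \<phi> provides a line.\<close>

lemma kirchhoff_sub_critical_slope:
  assumes sub: "kirchhoff_sub lam K B u"
    and \<phi>: "\<phi> \<in> C1 v" "0 < \<delta>" "max_point_on (jball v \<delta> 0) (\<lambda>z. u z - \<phi> z) 0"
    and K: "continuous_on (cl_edge v i \<times> UNIV) (\<lambda>(x, p). K i x p)"
    and b: "\<And>p. b < p \<Longrightarrow> slope_bound u i p" "\<And>p. p < b \<Longrightarrow> \<not> slope_bound u i p"
  shows "G0 lam i \<delta> u \<phi> + ereal (K i 0 b) \<le> 0"
proof (rule ccontr)
  assume "\<not> ?thesis"
  then have "0 < G0 lam i \<delta> u \<phi> + ereal (K i 0 b)" by simp
  from ereal_dense2[OF this] obtain \<eta>' where \<eta>': "0 < \<eta>'" "ereal \<eta>' < G0 lam i \<delta> u \<phi> + ereal (K i 0 b)"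
    by (auto simp: zero_ereal_def)
  \<comment> \<open>One third pays for the near term of the test functions, one for the change of
    radius at \<open>O\<close>, and one, in two halves, for the convergence of
    \<open>lam * u\<close> and the continuity of \<open>K\<close>.\<close>
  define \<eta> where "\<eta> = \<eta>' / 3"
  have \<eta>: "0 < \<eta>" "ereal (3 * \<eta>) < G0 lam i \<delta> u \<phi> + ereal (K i 0 b)" using \<eta>' by (auto simp: \<eta>_def)
  have u: "u \<in> USC v" using sub by (simp add: kirchhoff_sub_def)
  have zero: "0 \<in> cl_edge v i" using param_in_cl_edge[of 0 i] by simp

  obtain e where e: "0 < e" "\<And>x p. x \<in> cl_edge v i \<Longrightarrow> norm x < e \<Longrightarrow> \<bar>p - b\<bar> < e \<Longrightarrow> K i 0 b - \<eta> / 2 < K i x p"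
  proof -
    have "((\<lambda>(x, p). K i x p) \<longlongrightarrow> K i 0 b) (at (0, b) within cl_edge v i \<times> UNIV)"
      using K zero unfolding continuous_on_def by force
    then have "\<forall>\<^sub>F y in at (0, b) within cl_edge v i \<times> UNIV. K i 0 b - \<eta> / 2 < (\<lambda>(x, p). K i x p) y"
      by (rule order_tendstoD) (use \<eta> in simp)
    then obtain e where e: "0 < e" "\<And>y. y \<in> cl_edge v i \<times> UNIV \<Longrightarrow> 0 < dist y (0, b) \<Longrightarrow> dist y (0, b) < e \<Longrightarrow>
       K i 0 b - \<eta> / 2 < (\<lambda>(x, p). K i x p) y"
      by (auto simp: eventually_at)
    show ?thesis
    proof (rule that[of "e / 2"])
      fix x p assume x: "x \<in> cl_edge v i" "norm x < e / 2" "\<bar>p - b\<bar> < e / 2"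
      have "dist (x, p) (0, b) \<le> norm x + \<bar>p - b\<bar>"
        unfolding dist_Pair_Pair using sqrt_sum_squares_le_sum_abs[of "dist x 0" "dist p b"]
        by (simp add: dist_real_def)
      then show "K i 0 b - \<eta> / 2 < K i x p"
        using e(2)[of "(x, p)"] x \<eta>(1) by (cases "(x, p) = (0, b)") auto
    qed (use e in simp)
  qed

  \<comment> \<open>The test slopes stay within \<open>5 * \<epsilon>\<close> of \<open>b\<close>,
    hence within \<open>e\<close>; \<open>\<epsilon> \<le> 1\<close> gives a Lipschitz bound
    independent of \<epsilon>.\<close>
  define \<epsilon> where "\<epsilon> = min 1 (e / 10)"
  have \<epsilon>: "0 < \<epsilon>" "\<epsilon> \<le> 1" "5 * \<epsilon> < e" using e(1) by (auto simp: \<epsilon>_def min_def)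
  obtain r0 where r0: "0 < r0" "\<And>z. 0 < z \<Longrightarrow> z < r0 \<Longrightarrow> z < norm (v i) \<Longrightarrow> u (param v i z) \<le> u 0 + (b + \<epsilon>) * z"
    using b(1)[of "b + \<epsilon>"] \<epsilon>(1) unfolding slope_bound_def by auto
  define r where "r = min r0 (min \<delta> (norm (v i))) / 2"
  have r: "0 < r" "r < r0" "r < \<delta>" "r < norm (v i)"
    using r0(1) \<phi>(2) norm_pos[of i] unfolding r_def by linarith+
  have u_le: "u (param v i z) \<le> u 0 + (b + \<epsilon>) * z" if "0 \<le> z" "z \<le> r" for z
    using r0(2)[of z] that r by (cases "z = 0") auto
  obtain L where L: "0 \<le> L" "\<And>j z. 0 \<le> z \<Longrightarrow> z \<le> norm (v j) \<Longrightarrow> \<bar>\<phi> (param v j z) - \<phi> 0\<bar> \<le> L * z"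
    using C1_Lipschitz_at_0[OF \<phi>(1)] by blast
  \<comment> \<open>\<open>\<bar>b\<bar> + 7\<close> bounds
    \<open>\<bar>b - \<epsilon>\<bar> + 6 * \<epsilon>\<close>, a Lipschitz constant of the test
    functions on edge \<open>i\<close>; \<open>L\<close> is their slope on the other edges.\<close>
  define M where "M = L + \<bar>b\<bar> + 7"
  have M: "0 \<le> M" "L \<le> M" "\<bar>b\<bar> + 7 \<le> M" using L(1) by (auto simp: M_def)
  obtain d where d: "0 < d" "d \<le> r / 2" "M * kernel_const * d powr (1 - \<sigma>) < \<eta>"
    using small_radius[of \<eta> "M * kernel_const" "r / 2"] \<eta>(1) r(1) M(1) kernel_const_nonneg by auto

  define N where "N = (\<lambda>s. nonlocal v \<nu> i (jball_compl v d (param v i s)) u (param v i s))"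
  \<comment> \<open>The lower bound for \<open>u\<close> is recorded because upper semicontinuity
    alone does not make the values at the touching points converge to \<open>u 0\<close>.\<close>
  define touching where "touching = (\<lambda>k s q. 0 < s \<and> s \<le> 2 * k \<and> u 0 + (b - \<epsilon>) * s \<le> u (param v i s)
      \<and> u (param v i s) \<le> u 0 + (b + \<epsilon>) * s \<and> \<bar>q - b\<bar> \<le> 5 * \<epsilon>
      \<and> ereal (lam * u (param v i s)) - N s - ereal \<eta> + ereal (K i (param v i s) q) \<le> 0)"
  have touch: "\<exists>s q. touching k s q"
    if k: "0 < k" "4 * k \<le> r" for k
  proof -
    define h where "h = (\<lambda>z. sqrt (z\<^sup>2 + k\<^sup>2))"
    have pos: "0 < z\<^sup>2 + k\<^sup>2" for z using k by (simp add: add_nonneg_pos)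
    have h_der: "(h has_real_derivative z / h z) (at z)" for z
      unfolding h_def using pos[of z]
      by (auto intro!: derivative_eq_intros simp: field_simps)
    have h_pos: "0 < h z" and h_abs: "\<bar>z\<bar> \<le> h z" and h_k: "k \<le> h z" for z
    proof -
      show "0 < h z" using pos by (simp add: h_def)
      show "\<bar>z\<bar> \<le> h z" unfolding h_def by (rule real_le_rsqrt) simp
      show "k \<le> h z" unfolding h_def by (rule real_le_rsqrt) simp
    qed
    have h0: "h 0 = k" using k by (simp add: h_def)
    have slope_h: "\<bar>z / h z\<bar> \<le> 1" for z using h_pos[of z] h_abs[of z] by (simp add: divide_le_eq)
    have h_upper: "h z \<le> k + z\<^sup>2 / (2 * k)" for z
    proof -
      have "z\<^sup>2 + k\<^sup>2 \<le> (k + z\<^sup>2 / (2 * k))\<^sup>2"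
        using k by (simp add: power2_sum)
      then show ?thesis unfolding h_def using k by (intro real_le_lsqrt) auto
    qed
    have h_Lip: "\<bar>h t - h s\<bar> \<le> \<bar>t - s\<bar>" for s t
      using field_differentiable_bound[of UNIV h "\<lambda>z. z / h z" 1 t s] h_der slope_h by simp
    \<comment> \<open>The slope of \<open>h\<close> rises from 0 at the origin towards 1 for
      \<open>z\<close> large compared with \<open>k\<close>. Hence \<open>g i\<close> starts with
      slope \<open>b - \<epsilon>\<close>, which lets \<open>u\<close> rise above it near
      \<open>O\<close>, and its slope then increases towards \<open>b + 5 * \<epsilon>\<close>,
      which brings it back above \<open>u\<close>.\<close>
    define g where "g = (\<lambda>j z. if j = i then u 0 + (b - \<epsilon>) * z + 6 * \<epsilon> * (h z - k) else u 0 + L * z)"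
    define D where "D = (\<lambda>j z. if j = i then b - \<epsilon> + 6 * \<epsilon> * (z / h z) else L)"
    obtain \<psi> where \<psi>: "\<And>j s. 0 \<le> s \<Longrightarrow> \<psi> (param v j s) = g j s"
      by (rule glue_edge_functions[of g "u 0"]) (auto simp: g_def h0)
    have g_der: "(g j has_real_derivative D j z) (at z)" for j z
      unfolding g_def D_def by (auto intro!: derivative_eq_intros h_der)
    have D_cont: "continuous_on {0..} (D j)" for j
    proof -
      have "continuous_on {0..} h" by (rule continuous_at_imp_continuous_on) (blast intro: DERIV_isCont h_der)
      then show ?thesis unfolding D_def using h_pos by (cases "j = i") (auto intro!: continuous_intros simp: less_imp_neq[symmetric])
    qed
    note \<psi>_C1 = C1I[of \<psi>, OF \<psi> g_der D_cont]

    define f where "f = (\<lambda>z. (u \<circ> param v i) z + - g i z)"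
    have "usc_on {0..r} f" unfolding f_def
    proof (rule usc_on_add_continuous)
      show "usc_on {0..r} (u \<circ> param v i)"
        using u r(4) by (auto simp: USC_def intro: usc_on_subset)
      show "continuous_on {0..r} (\<lambda>z. - g i z)"
        by (intro continuous_intros continuous_at_imp_continuous_on) (blast intro: DERIV_isCont g_der)
    qed
    then obtain s where s: "0 \<le> s" "s \<le> r" and s_max: "\<And>z. 0 \<le> z \<Longrightarrow> z \<le> r \<Longrightarrow> f z \<le> f s"
      using usc_on_attains_sup[of "{0..r}" f] r(1) by auto
    \<comment> \<open>For \<open>y < k / 6\<close> the curved term, at most
      \<open>3 * \<epsilon> * y * y / k\<close>, is smaller than the gain
      \<open>\<epsilon> / 2 * y\<close> of the slope \<open>b - \<epsilon> / 2\<close> over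
      \<open>b - \<epsilon>\<close>.\<close>
    have "\<not> slope_bound u i (b - \<epsilon> / 2)" using b(2) \<epsilon>(1) by simp
    then have "\<exists>y>0. y < min r (k / 6) \<and> y < norm (v i) \<and> \<not> u (param v i y) \<le> u 0 + (b - \<epsilon> / 2) * y"
      using r(1) k(1) unfolding slope_bound_def by (metis divide_pos_pos min_less_iff_conj zero_less_numeral)
    then obtain y where y: "0 < y" "y < r" "y < k / 6" "u 0 + (b - \<epsilon> / 2) * y < u (param v i y)" by auto
    have f_s: "0 < f s"
    proof -
      have "y\<^sup>2 / (2 * k) < y / 12" using y k by (simp add: field_simps power2_eq_square)
      then have "6 * \<epsilon> * (h y - k) < 6 * \<epsilon> * (y / 12)" using h_upper[of y] \<epsilon>(1) by (intro mult_strict_left_mono) auto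
      then have "0 < f y" using y(4) by (simp add: f_def g_def algebra_simps)
      also have "\<dots> \<le> f s" using s_max y by simp
      finally show ?thesis .
    qed
    have f0: "f 0 = 0" by (simp add: f_def g_def h0)
    have s0: "0 < s" using f_s f0 s(1) by (cases "s = 0") auto
    \<comment> \<open>From \<open>s = 3 * k / 2\<close> on, \<open>6 * \<epsilon> * (s - k)\<close>
      is at least the gap \<open>2 * \<epsilon> * s\<close> between the lines of slopes
      \<open>b + \<epsilon>\<close> and \<open>b - \<epsilon>\<close>, so \<open>f\<close> could not
      be positive.\<close>
    have s_k: "s \<le> 2 * k"
    proof -
      have "6 * \<epsilon> * (s - k) \<le> 6 * \<epsilon> * (h s - k)" using h_abs[of s] s(1) \<epsilon>(1) by (intro mult_left_mono) auto
      then have "0 < \<epsilon> * (6 * k - 4 * s)" using f_s u_le[OF s] by (simp add: f_def g_def algebra_simps)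
      then have "0 < 6 * k - 4 * s" using \<epsilon>(1) by (simp add: zero_less_mult_iff)
      then show ?thesis using k by simp
    qed
    let ?x = "param v i s"
    have \<psi>_x: "u ?x - \<psi> ?x = f s" using \<psi>[OF s(1), of i] by (simp add: f_def)
    \<comment> \<open>On edge \<open>i\<close> the ball stays inside \<open>{0..r}\<close>, since
      \<open>s\<close> and \<open>d\<close> are at most \<open>r / 2\<close>. On the other edges
      \<open>u - \<psi>\<close> is at most 0, which lies below \<open>f s\<close>.\<close>
    have "max_point_on (jball v d ?x) (\<lambda>z. u z - \<psi> z) ?x"
      unfolding max_point_on_def \<psi>_x
    proof
      fix y assume y: "y \<in> jball v d ?x"
      then obtain j t where t: "0 \<le> t" "t \<le> norm (v j)" "y = param v j t"
        by (auto simp: jball_def elim: junction_cases)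
      have dist: "edge_dist i j s t < d" using y t s r(4) param_in_jball_iff(1)[of s i t j d] by simp
      show "u y - \<psi> y \<le> f s"
      proof (cases "j = i")
        case True
        then have "t \<le> r" using dist s_k k d(2) by (auto simp: edge_dist_def)
        then show ?thesis using s_max[of t] t \<psi>[of t j] True by (simp add: f_def)
      next
        case False
        then have "t < d" using dist s0 by (simp add: edge_dist_def)
        then have "u y - u 0 \<le> \<phi> y - \<phi> 0" using max_point_at_0[OF \<phi>(3), of t j] t d(2) r by simp
        also have "\<dots> \<le> L * t" using L(2)[of t j] t by simp
        finally show ?thesis using f_s \<psi>[of t j] t False by (simp add: g_def)
      qed
    qed
    then have G: "G v lam \<nu> K i d u \<psi> (D i s) ?x \<le> 0"
      using kirchhoff_sub_edge[OF sub d(1) \<psi>_C1(1) s0, of i] \<psi>_C1(2)[of s i] s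
        le_less_trans[OF s(2) r(4)] by simp
    define J where "J = nonlocal v \<nu> i (jball v d ?x) \<psi> ?x"
    have J: "J \<le> ereal \<eta>"
    proof -
      have "\<psi> (param v j t) - \<psi> ?x \<le> M * edge_dist i j s t" if "0 < t" for j t
      proof (cases "j = i")
        case True
        have "\<psi> (param v j t) - \<psi> ?x = (b - \<epsilon>) * (t - s) + 6 * \<epsilon> * (h t - h s)"
          using \<psi>[of t j] \<psi>[of s i] that s True by (simp add: g_def algebra_simps)
        also have "\<dots> \<le> \<bar>b - \<epsilon>\<bar> * \<bar>t - s\<bar> + 6 * \<epsilon> * \<bar>t - s\<bar>"
          using h_Lip[of t s] \<epsilon>(1) abs_ge_self[of "(b - \<epsilon>) * (t - s)"]
          by (intro add_mono mult_left_mono) (auto simp: abs_mult)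
        also have "\<dots> \<le> M * \<bar>t - s\<bar>"
          using M(3) \<epsilon>(1,2) by (auto simp: distrib_right[symmetric] intro!: mult_right_mono)
        finally show ?thesis using True by (simp add: edge_dist_def)
      next
        case False
        have "0 \<le> 6 * \<epsilon> * (h s - k)" using h_k[of s] \<epsilon>(1) by simp
        then have "\<psi> (param v j t) - \<psi> ?x \<le> L * t + (\<epsilon> - b) * s"
          using \<psi>[of t j] \<psi>[of s i] that s False by (simp add: g_def algebra_simps)
        also have "\<dots> \<le> M * t + M * s"
          using M \<epsilon>(2) that s by (intro add_mono mult_right_mono) auto
        finally show ?thesis using False by (simp add: edge_dist_def algebra_simps)
      qed
      then have "J \<le> ereal (M * kernel_const * d powr (1 - \<sigma>))"
        unfolding J_def using s r(4) d(1) M(1) by (intro nonlocal_ball_le) auto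
      also have "\<dots> \<le> ereal \<eta>" using d(3) by simp
      finally show ?thesis .
    qed
    have q: "\<bar>D i s - b\<bar> \<le> 5 * \<epsilon>"
    proof -
      have "0 \<le> s / h s" "s / h s \<le> 1" using slope_h[of s] h_pos[of s] s by auto
      then have "0 \<le> 6 * \<epsilon> * (s / h s)" "6 * \<epsilon> * (s / h s) \<le> 6 * \<epsilon>"
        using \<epsilon>(1) mult_left_le[of "s / h s" "6 * \<epsilon>"] mult_nonneg_nonneg[of "6 * \<epsilon>" "s / h s"]
        by simp_all
      then show ?thesis using \<epsilon>(1) by (auto simp: D_def abs_le_iff)
    qed
    have G': "ereal (lam * u ?x) - N s - J + ereal (K i ?x (D i s)) \<le> 0"
      using G by (simp add: G_def N_def J_def)
    have "N s < \<infinity>" unfolding N_def using s r(4) d(1) u by (intro nonlocal_far_less_top) auto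
    then have "ereal (lam * u ?x) - N s - ereal \<eta> + ereal (K i ?x (D i s)) \<le> 0"
      using G' J by (cases "N s"; cases J) auto
    moreover have "u 0 + (b - \<epsilon>) * s \<le> u ?x"
    proof -
      have "0 \<le> 6 * \<epsilon> * (h s - k)" using h_k[of s] \<epsilon>(1) by simp
      then show ?thesis using f_s by (simp add: f_def g_def)
    qed
    ultimately show ?thesis using s0 s_k u_le[OF s] q unfolding touching_def by blast
  qed

  define k where "k = (\<lambda>n. r / 4 * inverse (real (Suc n)))"
  have "0 < k n \<and> 4 * k n \<le> r" for n
    using r(1) by (auto simp: k_def field_simps)
  then have "\<forall>n. \<exists>s q. touching (k n) s q" using touch by blast
  then obtain s q where "\<And>n. touching (k n) (s n) (q n)" by metis
  then have s: "\<And>n. 0 < s n" "\<And>n. s n \<le> 2 * k n" "\<And>n. u 0 + (b - \<epsilon>) * s n \<le> u (param v i (s n))"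
      "\<And>n. u (param v i (s n)) \<le> u 0 + (b + \<epsilon>) * s n" "\<And>n. \<bar>q n - b\<bar> \<le> 5 * \<epsilon>"
      "\<And>n. ereal (lam * u (param v i (s n))) - N (s n) - ereal \<eta> + ereal (K i (param v i (s n)) (q n)) \<le> 0"
    by (auto simp: touching_def)
  have s_le: "s n \<le> norm (v i)" for n
    using s(2)[of n] \<open>0 < k n \<and> 4 * k n \<le> r\<close> r(4) by linarith
  have "(\<lambda>n. 2 * (r / 4 * inverse (real (Suc n)))) \<longlonglongrightarrow> 2 * (r / 4 * 0)"
    by (intro tendsto_intros LIMSEQ_inverse_real_of_nat)
  then have s_lim: "s \<longlonglongrightarrow> 0"
    using s(1,2) by (intro tendsto_sandwich[of "\<lambda>_. 0" s _ "\<lambda>n. 2 * k n"]) (auto simp: k_def less_imp_le)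
  have u_lim: "(\<lambda>n. u (param v i (s n))) \<longlonglongrightarrow> u 0"
  proof (rule tendsto_sandwich)
    show "(\<lambda>n. u 0 + (b - \<epsilon>) * s n) \<longlonglongrightarrow> u 0" "(\<lambda>n. u 0 + (b + \<epsilon>) * s n) \<longlonglongrightarrow> u 0"
      using s_lim by (auto intro!: tendsto_eq_intros)
  qed (use s(3,4) in auto)
  define I J where "I = nonlocal v \<nu> i (jball_compl v \<delta> 0) u 0" and "J = nonlocal v \<nu> i (jball v \<delta> 0) \<phi> 0"
  have "I < \<infinity>" "J < \<infinity>"
    using nonlocal_far_less_top[of 0 i \<delta> u] nonlocal_near_less_top[of 0 i \<delta> \<phi>] \<phi> u
    by (simp_all add: I_def J_def)
  moreover have "nonlocal v \<nu> i (jball_compl v d 0) u 0 \<le> I + J + ereal \<eta>"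
  proof -
    have "nonlocal v \<nu> i (jball_compl v d 0) u 0 \<le> I + J + ereal (M * kernel_const * d powr (1 - \<sigma>))"
      unfolding I_def J_def
    proof (rule nonlocal_far_le[OF u \<phi>(1) d(1) _ M(1)])
      show "\<bar>\<phi> (param v j z) - \<phi> 0\<bar> \<le> M * z" if "0 < z" "z < norm (v j)" for j z
        using L(2)[OF less_imp_le[OF that(1)] less_imp_le[OF that(2)]]
          mult_right_mono[OF M(2) less_imp_le[OF that(1)]] by linarith
    qed (use d r max_point_at_0[OF \<phi>(3)] in auto)
    also have "\<dots> \<le> I + J + ereal \<eta>" using d(3) by (intro add_left_mono) simp
    finally show ?thesis .
  qed
  moreover have "ereal (3 * \<eta>) < ereal (lam * u 0) - I - J + ereal (K i 0 b)"
    using \<eta>(2) by (simp add: G0_def I_def J_def)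
  ultimately have "nonlocal v \<nu> i (jball_compl v d 0) u 0 < ereal (lam * u 0 + K i 0 b - 2 * \<eta>)"
    by (cases I; cases J; cases "nonlocal v \<nu> i (jball_compl v d 0) u 0") auto
  from nonlocal_far_limsup[OF u d(1) less_imp_le[OF s(1)] s_le s_lim u_lim this]
  have "\<forall>\<^sub>F n in sequentially. N (s n) < ereal (lam * u 0 + K i 0 b - 2 * \<eta>)" by (simp add: N_def)
  moreover have "\<forall>\<^sub>F n in sequentially. s n < e" using s_lim e(1) by (rule order_tendstoD)
  moreover have "\<forall>\<^sub>F n in sequentially. lam * u 0 - \<eta> / 2 < lam * u (param v i (s n))"
    using \<eta>(1) by (intro order_tendstoD(1)[OF tendsto_mult_left[OF u_lim]]) simp
  ultimately have "\<forall>\<^sub>F n in sequentially. False"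
  proof eventually_elim
    case (elim n)
    have "K i 0 b - \<eta> / 2 < K i (param v i (s n)) (q n)"
      using elim(2) s(1)[of n] s(5)[of n] \<epsilon>(3) s_le[of n] param_in_cl_edge[of "s n" i]
      by (intro e(2)) (auto simp: norm_param)
    with elim s(6)[of n] show False
      by (cases "N (s n)") auto
  qed
  then show False by simp
qed

section \<open>Flux-limited solutions\<close>

text \<open>In the first alternative the critical slope is -\<infinity> and no equation at
  \<open>O\<close> results. Coercivity excludes it for subsolutions; for reflected supersolutions it
  directly supplies the admissible slopes that are wanted.\<close>

lemma critical_slope_cases:
  assumes sub: "kirchhoff_sub lam K B u"
    and \<phi>: "\<phi> \<in> C1 v" "0 < \<delta>" "max_point_on (jball v \<delta> 0) (\<lambda>z. u z - \<phi> z) 0"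
    and K: "continuous_on (cl_edge v i \<times> UNIV) (\<lambda>(x, p). K i x p)"
  obtains "\<And>p. slope_bound u i p"
  | b where "\<And>p. b < p \<Longrightarrow> slope_bound u i p" "b \<le> edge_deriv v \<phi> i 0"
      "G0 lam i \<delta> u \<phi> + ereal (K i 0 b) \<le> 0"
proof (cases "Collect (slope_bound u i) = UNIV")
  case True
  then show ?thesis using that(1) by auto
next
  case False
  have above: "slope_bound u i p" if "edge_deriv v \<phi> i 0 < p" for p
    using slope_bound_deriv[OF \<phi> that] .
  have ne: "Collect (slope_bound u i) \<noteq> {}" using above[of "edge_deriv v \<phi> i 0 + 1"] by auto
  obtain b where b: "\<And>p. b < p \<Longrightarrow> slope_bound u i p" "\<And>p. p < b \<Longrightarrow> \<not> slope_bound u i p"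
    by (rule critical_slope_exists[OF ne False]) (auto intro: slope_bound_mono)
  have "b \<le> edge_deriv v \<phi> i 0"
    using above b(2) by (meson dense not_le)
  with b kirchhoff_sub_critical_slope[OF sub \<phi> K b] show ?thesis using that(2) by blast
qed

text \<open>The vector \<open>q\<close> is a competitor in the flux limiter with nonpositive value,
  which bounds the infimum.\<close>

lemma kirchhoff_sub_imp_FL:
  assumes sub: "kirchhoff_sub lam H B u"
    and \<phi>: "\<phi> \<in> C1 v" "0 < \<delta>" "max_point_on (jball v \<delta> 0) (\<lambda>z. u z - \<phi> z) 0"
    and cont: "\<And>i. continuous_on (cl_edge v i \<times> UNIV) (\<lambda>(x, p). H i x p)"
    and conv: "\<And>i. convex_on UNIV (H i 0)"
    and amin: "\<And>i p. H i 0 (argmin_H H i 0) \<le> H i 0 p"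
    and coercive: "0 < C" "\<And>i p. inverse C * \<bar>p\<bar> - C \<le> H i 0 p"
  shows "(\<forall>i. G0 lam i \<delta> u \<phi> + ereal (H_plus H i 0 (edge_deriv v \<phi> i 0)) \<le> 0) \<and>
    (\<exists>q. (\<forall>i. G0 lam i \<delta> u \<phi> + ereal (H_minus H i 0 (q i)) \<le> 0) \<and> (\<Sum>i\<in>UNIV. - q i) - B \<le> 0)"
proof -
  let ?A = "\<lambda>i. G0 lam i \<delta> u \<phi>"
  have u: "u \<in> USC v" using sub by (simp add: kirchhoff_sub_def)
  have large: "m < H i 0 p" if "C * (\<bar>m\<bar> + C) < \<bar>p\<bar>" for i m p
  proof -
    have "\<bar>m\<bar> + C < inverse C * \<bar>p\<bar>" using that coercive(1) by (simp add: field_simps)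
    then show ?thesis using coercive(2)[of p i] by linarith
  qed
  have "\<exists>m. ereal (- m) < ?A i" for i
  proof -
    have "- \<infinity> < ?A i"
      using nonlocal_far_less_top[of 0 i \<delta> u] nonlocal_near_less_top[of 0 i \<delta> \<phi>] u \<phi>
      unfolding G0_def
      by (cases "nonlocal v \<nu> i (jball_compl v \<delta> 0) u 0"; cases "nonlocal v \<nu> i (jball v \<delta> 0) \<phi> 0") auto
    from ereal_dense2[OF this] show ?thesis by (metis minus_minus)
  qed
  then obtain m where m: "\<And>i. ereal (- m i) < ?A i" by metis
  \<comment> \<open>At slopes of absolute value at least \<open>T\<close>, coercivity outweighs the
    lower bounds \<open>- m i\<close> of \<open>?A i\<close> and every edge equation fails.
    \<open>T\<close> also exceeds the derivatives of \<phi>, so it is admissible on every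
    edge.\<close>
  define T where "T = (\<Sum>i\<in>UNIV. C * (\<bar>m i\<bar> + C) + \<bar>edge_deriv v \<phi> i 0\<bar>) + 1"
  have T: "C * (\<bar>m i\<bar> + C) < T" "edge_deriv v \<phi> i 0 < T" for i
  proof -
    have "C * (\<bar>m i\<bar> + C) + \<bar>edge_deriv v \<phi> i 0\<bar> \<le> T - 1"
      unfolding T_def using coercive(1)
      by (simp, intro member_le_sum) auto
    then show "C * (\<bar>m i\<bar> + C) < T" "edge_deriv v \<phi> i 0 < T"
      using coercive(1) mult_nonneg_nonneg[of C "\<bar>m i\<bar> + C"] by linarith+
  qed
  have pos: "0 < ?A i + ereal (H i 0 p)" if "T \<le> \<bar>p\<bar>" for i p
  proof -
    have "m i < H i 0 p" using T(1)[of i] that by (intro large) auto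
    with m[of i] show ?thesis by (cases "?A i") auto
  qed
  have not_all: "\<not> (\<forall>p. slope_bound u i p)" for i
  proof
    assume all: "\<forall>p. slope_bound u i p"
    \<comment> \<open>Slope \<open>- P\<close> on edge \<open>i\<close> and \<open>T\<close>
      elsewhere would violate all edge equations; \<open>P\<close> outweighs the other slopes by
      enough to violate the Kirchhoff inequality as well.\<close>
    define P where "P = (real CARD('n) * T + \<bar>B\<bar> + 1)"
    define p where "p = (\<lambda>j. if j = i then - P else T)"
    have T0: "0 < T" using T(1)[of i] coercive(1) mult_nonneg_nonneg[of C "\<bar>m i\<bar> + C"] by linarith
    have "T \<le> real CARD('n) * T"
      using T0 mult_right_mono[of 1 "real CARD('n)" T] by (simp add: Suc_leI)
    then have P: "T \<le> P" by (simp add: P_def)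
    have "slope_bound u j (p j)" for j
      using all slope_bound_deriv[OF \<phi> T(2)[of j]] by (simp add: p_def)
    from kirchhoff_sub_slopes[OF sub \<phi> this]
    have "(\<exists>j. ?A j + ereal (H j 0 (p j)) \<le> 0) \<or> (\<Sum>j\<in>UNIV. - p j) - B \<le> 0" .
    moreover have "0 < ?A j + ereal (H j 0 (p j))" for j
      using P T0 by (intro pos) (auto simp: p_def)
    ultimately have "(\<Sum>j\<in>UNIV. - p j) - B \<le> 0" by (meson not_le)
    moreover have "(\<Sum>j\<in>UNIV. - p j) = P - (\<Sum>j\<in>UNIV - {i}. T)"
      by (subst sum.remove[of UNIV i]) (auto simp: p_def sum_negf)
    moreover have "(\<Sum>j\<in>UNIV - {i}. T) \<le> real CARD('n) * T"
      using T0 by (simp add: card_Diff_singleton)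
    ultimately show False by (simp add: P_def)
  qed
  have "\<exists>b. (\<forall>p>b. slope_bound u i p) \<and> b \<le> edge_deriv v \<phi> i 0 \<and> ?A i + ereal (H i 0 b) \<le> 0" for i
    using critical_slope_cases[OF sub \<phi> cont, of i] not_all[of i] by metis
  then obtain b where b: "\<And>i p. b i < p \<Longrightarrow> slope_bound u i p" "\<And>i. b i \<le> edge_deriv v \<phi> i 0"
      "\<And>i. ?A i + ereal (H i 0 (b i)) \<le> 0"
    by metis
  have plus: "?A i + ereal (H_plus H i 0 (edge_deriv v \<phi> i 0)) \<le> 0" for i
  proof -
    have "H_plus H i 0 (edge_deriv v \<phi> i 0) \<le> H i 0 (b i)"
      using convex_on_towards_minimum[OF conv amin, of "b i" "edge_deriv v \<phi> i 0" i] b(2)[of i] amin[of i "b i"]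
      by (auto simp: H_plus_def)
    then have "?A i + ereal (H_plus H i 0 (edge_deriv v \<phi> i 0)) \<le> ?A i + ereal (H i 0 (b i))"
      by (intro add_left_mono) simp
    with b(3)[of i] show ?thesis by (rule order_trans[rotated])
  qed
  \<comment> \<open>The supremum is attained, the set being closed by continuity and bounded by
    \<open>T\<close>. It is at least \<open>b i\<close>, so all larger slopes are
    admissible.\<close>
  define q where "q = (\<lambda>i. Sup {p. ?A i + ereal (H i 0 p) \<le> 0})"
  have q: "?A i + ereal (H i 0 (q i)) \<le> 0" "\<And>p. q i < p \<Longrightarrow> 0 < ?A i + ereal (H i 0 p)" "b i \<le> q i" for i
  proof -
    obtain a where a: "?A i = ereal a" using m[of i] b(3)[of i] by (cases "?A i") auto
    let ?Q = "{p. ?A i + ereal (H i 0 p) \<le> 0}"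
    have Q: "?Q = {p. a + H i 0 p \<le> 0}" by (simp add: a)
    have "continuous_on UNIV (\<lambda>p. (\<lambda>(x, p). H i x p) (0, p))"
      by (rule continuous_on_compose2[OF cont[of i]])
         (use param_in_cl_edge[of 0 i] in \<open>auto intro!: continuous_intros\<close>)
    then have "closed ?Q" unfolding Q by (intro closed_Collect_le continuous_intros) simp
    moreover have "p \<le> T" if "p \<in> ?Q" for p
    proof (rule ccontr)
      assume "\<not> p \<le> T"
      then have "0 < ?A i + ereal (H i 0 p)" by (intro pos) simp
      with that show False by (simp add: leD)
    qed
    then have bdd: "bdd_above ?Q" by (rule bdd_aboveI[of _ T])
    moreover have bQ: "b i \<in> ?Q" using b(3) by simp
    ultimately have "q i \<in> ?Q" unfolding q_def by (intro closed_contains_Sup) auto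
    then show "?A i + ereal (H i 0 (q i)) \<le> 0" by simp
    show "b i \<le> q i" unfolding q_def by (rule cSup_upper[OF bQ bdd])
    show "0 < ?A i + ereal (H i 0 p)" if "q i < p" for p
      using that cSup_upper[OF _ bdd, of p] unfolding q_def by (auto simp: not_le[symmetric])
  qed
  have "(\<Sum>i\<in>UNIV. - q i) - B \<le> 0"
  proof (rule field_le_epsilon)
    fix e :: real assume e: "0 < e"
    define \<eta> where "\<eta> = e / real CARD('n)"
    have \<eta>: "0 < \<eta>" using e by (simp add: \<eta>_def)
    have "slope_bound u i (q i + \<eta>)" for i using q(3)[of i] \<eta> by (intro b(1)) simp
    from kirchhoff_sub_slopes[OF sub \<phi> this]
    have "(\<exists>i. ?A i + ereal (H i 0 (q i + \<eta>)) \<le> 0) \<or> (\<Sum>i\<in>UNIV. - (q i + \<eta>)) - B \<le> 0" .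
    moreover have "0 < ?A i + ereal (H i 0 (q i + \<eta>))" for i using q(2) \<eta> by simp
    ultimately have "(\<Sum>i\<in>UNIV. - (q i + \<eta>)) - B \<le> 0" by (meson not_le)
    then show "(\<Sum>i\<in>UNIV. - q i) - B \<le> 0 + e" by (simp add: sum_subtractf sum_negf \<eta>_def)
  qed
  moreover have "?A i + ereal (H_minus H i 0 (q i)) \<le> 0" for i
  proof -
    have "H_minus H i 0 (q i) \<le> H i 0 (q i)" using amin by (simp add: H_minus_def)
    then have "?A i + ereal (H_minus H i 0 (q i)) \<le> ?A i + ereal (H i 0 (q i))"
      by (intro add_left_mono) simp
    with q(1)[of i] show ?thesis by (rule order_trans[rotated])
  qed
  ultimately show ?thesis using plus by blast
qed

text \<open>By convexity, the equation fails strictly at every slope between the derivative of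
  \<phi> and the raised slope \<open>p' i\<close>. The critical slope of \<open>u\<close> is not
  below the derivative of \<phi> and satisfies the equation, so it lies beyond \<open>p' i\<close>;
  thus \<open>p' i\<close> is admissible.\<close>

lemma kirchhoff_super_imp_FL:
  assumes super: "kirchhoff_sub lam (\<lambda>i x p. - H i x (- p)) (- B) (\<lambda>x. - u x)"
    and \<phi>: "\<phi> \<in> C1 v" "0 < \<delta>" "min_point_on (jball v \<delta> 0) (\<lambda>z. u z - \<phi> z) 0"
    and cont: "\<And>i. continuous_on (cl_edge v i \<times> UNIV) (\<lambda>(x, p). H i x p)"
    and conv: "\<And>i. convex_on UNIV (H i 0)"
    and amin: "\<And>i p. H i 0 (argmin_H H i 0) \<le> H i 0 p"
    and plus: "\<And>i. G0 lam i \<delta> u \<phi> + ereal (H_plus H i 0 (edge_deriv v \<phi> i 0)) < 0"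
    and minus: "\<And>i. G0 lam i \<delta> u \<phi> + ereal (H_minus H i 0 (p i)) < 0"
  shows "0 \<le> (\<Sum>i\<in>UNIV. - p i) - B"
proof -
  let ?A = "\<lambda>i. G0 lam i \<delta> u \<phi>" and ?K = "\<lambda>i x p. - H i x (- p)"
  let ?u = "\<lambda>x. - u x" and ?\<phi> = "\<lambda>x. - \<phi> x"
  have u: "u \<in> LSC v"
    using super by (simp add: kirchhoff_sub_def USC_def LSC_def lsc_on_iff_usc_on o_def)
  \<comment> \<open>With zero Hamiltonian, \<open>G\<close> at \<open>O\<close> is just
    \<open>G0\<close>.\<close>
  have A: "G0 lam i \<delta> ?u ?\<phi> = - ?A i" for i
    using G_uminus[of 0 i \<delta> u \<phi> lam "\<lambda>_ _ _. 0" 0] u \<phi> by (simp add: G_eq_G0)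
  have \<phi>': "?\<phi> \<in> C1 v" "edge_deriv v ?\<phi> i 0 = - edge_deriv v \<phi> i 0" for i
    using C1_uminus(1)[OF \<phi>(1)] C1_uminus(2)[OF \<phi>(1), of 0 i] by simp_all
  have max: "max_point_on (jball v \<delta> 0) (\<lambda>z. ?u z - ?\<phi> z) 0"
    using \<phi>(3) by (auto simp: max_point_on_def min_point_on_def)
  have K: "continuous_on (cl_edge v i \<times> UNIV) (\<lambda>(x, p). ?K i x p)" for i
  proof -
    have "continuous_on (cl_edge v i \<times> UNIV) (\<lambda>y. (\<lambda>(x, p). H i x p) (fst y, - snd y))"
      by (rule continuous_on_compose2[OF cont[of i]]) (auto intro!: continuous_intros)
    then show ?thesis by (auto simp: case_prod_unfold intro!: continuous_intros)
  qed
  have neg: "\<not> - ?A i + ereal (- H i 0 x) \<le> 0" if "?A i + ereal (H i 0 x) < 0" for i x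
    using that by (cases "?A i") auto
  \<comment> \<open>Raising \<open>p i\<close> to the minimum point keeps \<open>H_minus\<close> and
    makes \<open>H\<close> equal to it. It can only decrease the Kirchhoff term, so a lower bound
    proved for \<open>p'\<close> passes to \<open>p\<close>.\<close>
  define p' where "p' = (\<lambda>i. max (p i) (argmin_H H i 0))"
  have H_p': "H i 0 (p' i) = H_minus H i 0 (p i)" for i
    by (auto simp: p'_def H_minus_def max_def)
  have "slope_bound ?u i (- p' i)" for i
  proof (rule critical_slope_cases[OF super \<phi>'(1) \<phi>(2) max K, of i])
    fix b assume b: "\<And>p. b < p \<Longrightarrow> slope_bound ?u i p" "b \<le> edge_deriv v ?\<phi> i 0"
      "G0 lam i \<delta> ?u ?\<phi> + ereal (- H i 0 (- b)) \<le> 0"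
    have "p' i < - b"
    proof (rule ccontr)
      assume "\<not> p' i < - b"
      then have le: "- b \<le> p' i" "edge_deriv v \<phi> i 0 \<le> - b" using b(2) \<phi>'(2) by auto
      \<comment> \<open>Left of the minimum point \<open>- b\<close> is compared with the derivative
        of \<phi> on the decreasing branch, right of it with \<open>p' i\<close> on the increasing
        branch.\<close>
      have "?A i + ereal (H i 0 (- b)) < 0"
      proof (cases "- b \<le> argmin_H H i 0")
        case True
        then have "H i 0 (- b) \<le> H_plus H i 0 (edge_deriv v \<phi> i 0)"
          using convex_on_towards_minimum[OF conv amin, of "edge_deriv v \<phi> i 0" "- b" i] le
          by (auto simp: H_plus_def)
        then have "?A i + ereal (H i 0 (- b)) \<le> ?A i + ereal (H_plus H i 0 (edge_deriv v \<phi> i 0))"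
          by (intro add_left_mono) simp
        then show ?thesis using plus[of i] by (rule le_less_trans)
      next
        case False
        then have "H i 0 (- b) \<le> H i 0 (p' i)"
          using convex_on_towards_minimum[OF conv amin, of "p' i" "- b" i] le by auto
        then have "?A i + ereal (H i 0 (- b)) \<le> ?A i + ereal (H_minus H i 0 (p i))"
          unfolding H_p' by (intro add_left_mono) simp
        then show ?thesis using minus[of i] by (rule le_less_trans)
      qed
      from neg[OF this] b(3) show False by (simp add: A)
    qed
    then show ?thesis by (intro b(1)) simp
  qed
  from kirchhoff_sub_slopes[OF super \<phi>'(1) \<phi>(2) max this]
  have "(\<exists>i. - ?A i + ereal (- H i 0 (p' i)) \<le> 0) \<or> (\<Sum>i\<in>UNIV. p' i) + B \<le> 0"
    by (simp add: A)
  moreover have "\<not> - ?A i + ereal (- H i 0 (p' i)) \<le> 0" for i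
    using minus[of i] by (intro neg) (simp add: H_p')
  ultimately have "(\<Sum>i\<in>UNIV. p' i) + B \<le> 0" by blast
  moreover have "(\<Sum>i\<in>UNIV. p i) \<le> (\<Sum>i\<in>UNIV. p' i)" by (intro sum_mono) (simp add: p'_def)
  ultimately show ?thesis by (simp add: sum_negf)
qed

section \<open>Reduction of both kinds of solutions to \<open>kirchhoff_sub\<close>\<close>

lemma kirchhoff_subsolution_imp_sub:
  assumes "kirchhoff_subsolution v lam \<nu> H B h u"
  shows "kirchhoff_sub lam H B u"
  unfolding kirchhoff_sub_def
proof (intro conjI allI impI ballI)
  show "u \<in> USC v" using assms by (simp add: kirchhoff_subsolution_def)
  fix \<delta> :: real and \<phi> assume \<phi>: "0 < \<delta>" "\<phi> \<in> C1 v"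
  show "G v lam \<nu> H i \<delta> u \<phi> (edge_deriv v \<phi> i (param v i s)) (param v i s) \<le> 0"
    if "0 < s" "s < norm (v i)" "max_point_on (jball v \<delta> (param v i s)) (\<lambda>z. u z - \<phi> z) (param v i s)" for i s
    using assms \<phi> that param_in_junction[of s i] unfolding kirchhoff_subsolution_def by (auto simp: edge_eq)
  assume "max_point_on (jball v \<delta> 0) (\<lambda>z. u z - \<phi> z) 0"
  moreover have "0 \<in> junction v" using param_in_junction[of 0] by simp
  ultimately have "min (MIN i. G v lam \<nu> H i \<delta> u \<phi> (edge_deriv v \<phi> i 0) 0)
      (ereal ((\<Sum>i\<in>UNIV. - edge_deriv v \<phi> i 0) - B)) \<le> 0"
    using assms \<phi> unfolding kirchhoff_subsolution_def by blast
  then show "(\<exists>i. G v lam \<nu> H i \<delta> u \<phi> (edge_deriv v \<phi> i 0) 0 \<le> 0) \<or> (\<Sum>i\<in>UNIV. - edge_deriv v \<phi> i 0) - B \<le> 0"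
    by (simp add: min_le_iff_disj Min_le_iff)
qed

lemma kirchhoff_supersolution_imp_sub_uminus:
  assumes "kirchhoff_supersolution v lam \<nu> H B h u"
  shows "kirchhoff_sub lam (\<lambda>i x p. - H i x (- p)) (- B) (\<lambda>x. - u x)"
  unfolding kirchhoff_sub_def
proof (intro conjI allI impI ballI)
  have u: "u \<in> LSC v" using assms by (simp add: kirchhoff_supersolution_def)
  then show "(\<lambda>x. - u x) \<in> USC v" by (simp add: USC_def LSC_def lsc_on_iff_usc_on o_def)
  fix \<delta> :: real and \<phi> assume \<delta>: "0 < \<delta>" and \<phi>: "\<phi> \<in> C1 v"
  let ?\<phi> = "\<lambda>x. - \<phi> x"
  have \<phi>': "?\<phi> \<in> C1 v" by (rule C1_uminus[OF \<phi>])
  have max_min: "min_point_on S (\<lambda>z. u z - ?\<phi> z) x" if "max_point_on S (\<lambda>z. - u z - \<phi> z) x" for S x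
    using that by (force simp: max_point_on_def min_point_on_def)
  have G: "G v lam \<nu> (\<lambda>i x p. - H i x (- p)) i \<delta> (\<lambda>x. - u x) \<phi> (edge_deriv v \<phi> i (param v i s)) (param v i s)
      = - G v lam \<nu> H i \<delta> u ?\<phi> (edge_deriv v ?\<phi> i (param v i s)) (param v i s)"
    if "0 \<le> s" "s \<le> norm (v i)" for i s
    using G_uminus[OF that \<delta> u \<phi>', of lam H "- edge_deriv v \<phi> i (param v i s)"] C1_uminus(2)[OF \<phi> that] by simp
  show "G v lam \<nu> (\<lambda>i x p. - H i x (- p)) i \<delta> (\<lambda>x. - u x) \<phi> (edge_deriv v \<phi> i (param v i s)) (param v i s) \<le> 0"
    if "0 < s" "s < norm (v i)" "max_point_on (jball v \<delta> (param v i s)) (\<lambda>z. - u z - \<phi> z) (param v i s)" for i s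
  proof -
    have "0 \<le> G v lam \<nu> H i \<delta> u ?\<phi> (edge_deriv v ?\<phi> i (param v i s)) (param v i s)"
      using assms \<delta> \<phi>' that(1,2) param_in_junction[of s i] max_min[OF that(3)]
      unfolding kirchhoff_supersolution_def by (auto simp: edge_eq)
    then show ?thesis using G[of s i] that by simp
  qed
  assume "max_point_on (jball v \<delta> 0) (\<lambda>z. - u z - \<phi> z) 0"
  from max_min[OF this]
  have "0 \<le> max (MAX i. G v lam \<nu> H i \<delta> u ?\<phi> (edge_deriv v ?\<phi> i 0) 0)
      (ereal ((\<Sum>i\<in>UNIV. - edge_deriv v ?\<phi> i 0) - B))"
    using assms \<delta> \<phi>' param_in_junction[of 0] unfolding kirchhoff_supersolution_def by fastforce
  then have "(\<exists>i. 0 \<le> G v lam \<nu> H i \<delta> u ?\<phi> (edge_deriv v ?\<phi> i 0) 0) \<or>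
      0 \<le> (\<Sum>i\<in>UNIV. - edge_deriv v ?\<phi> i 0) - B"
    by (simp add: le_max_iff_disj Max_ge_iff)
  then show "(\<exists>i. G v lam \<nu> (\<lambda>i x p. - H i x (- p)) i \<delta> (\<lambda>x. - u x) \<phi> (edge_deriv v \<phi> i 0) 0 \<le> 0) \<or>
      (\<Sum>i\<in>UNIV. - edge_deriv v \<phi> i 0) - - B \<le> 0"
  proof
    assume "\<exists>i. 0 \<le> G v lam \<nu> H i \<delta> u ?\<phi> (edge_deriv v ?\<phi> i 0) 0"
    then show ?thesis using G[of 0] by auto
  next
    assume "0 \<le> (\<Sum>i\<in>UNIV. - edge_deriv v ?\<phi> i 0) - B"
    then show ?thesis using C1_uminus(2)[OF \<phi>, of 0] by (simp add: sum_negf)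
  qed
qed

end

theorem theorem8p4:
  fixes v :: "'n::finite \<Rightarrow> 'a::euclidean_space"
    and lam B :: real
    and H :: "'n \<Rightarrow> 'a \<Rightarrow> real \<Rightarrow> real"
    and \<nu> :: "'n \<Rightarrow> 'n \<Rightarrow> 'a \<Rightarrow> real \<Rightarrow> real"
    and h :: "'n \<Rightarrow> real"
  assumes "DIM('a) \<ge> 2"
    and "noncollinear_vectors v"
    and "lam > 0"
    and "hamiltonian_assms v H"
    and "kernel_assms v \<nu>"
  shows "(\<forall>u. kirchhoff_subsolution v lam \<nu> H B h u \<longrightarrow> FL_subsolution v lam \<nu> H B h u) \<and>
         (\<forall>u. kirchhoff_supersolution v lam \<nu> H B h u \<longrightarrow> FL_supersolution v lam \<nu> H B h u)"
proof -
  interpret junction_vectors v by unfold_locales (rule assms(2))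
  obtain \<Lambda> \<sigma> where "0 < \<Lambda>" "0 < \<sigma>" "\<sigma> < 1" and kernel:
    "\<And>i j x y r. x \<in> cl_edge v i \<Longrightarrow> y \<in> cl_edge v i \<Longrightarrow> 0 < r \<Longrightarrow>
      0 \<le> \<nu> i j x r \<and> \<nu> i j x r \<le> \<Lambda> * r powr (- 1 - \<sigma>) \<and>
      \<bar>\<nu> i j x r - \<nu> i j y r\<bar> \<le> \<Lambda> * r powr (- 1 - \<sigma>) * norm (x - y)"
    using assms(5) unfolding kernel_assms_def by (elim conjE exE) blast
  interpret junction_kernel v \<nu> \<Lambda> \<sigma>
    using assms(5) kernel \<open>0 < \<Lambda>\<close> \<open>0 < \<sigma>\<close> \<open>\<sigma> < 1\<close>
    by unfold_locales (auto simp: kernel_assms_def)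
  have zero: "0 \<in> cl_edge v i" for i using param_in_cl_edge[of 0 i] by simp
  have cont: "continuous_on (cl_edge v i \<times> UNIV) (\<lambda>(x, p). H i x p)" for i
    using assms(4) by (simp add: hamiltonian_assms_def)
  have conv: "convex_on UNIV (H i 0)" and amin: "H i 0 (argmin_H H i 0) \<le> H i 0 p" for i p
    using assms(4) zero[of i] argmin_H_le[of H i 0 p] by (auto simp: hamiltonian_assms_def)
  obtain C where C: "C > 1" "\<And>i p. inverse C * \<bar>p\<bar> - C \<le> H i 0 p"
    using assms(4) zero unfolding hamiltonian_assms_def by blast

  have sub: "FL_subsolution v lam \<nu> H B h u" if u: "kirchhoff_subsolution v lam \<nu> H B h u" for u
    unfolding FL_subsolution_def
  proof (intro conjI ballI impI)
    show "u \<in> USC v" using u by (simp add: kirchhoff_subsolution_def)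
    fix x \<delta> \<phi> assume *: "x \<in> junction v" "\<delta> \<in> {0<..<1}" "\<phi> \<in> C1 v"
      "max_point_on (jball v \<delta> x) (\<lambda>z. u z - \<phi> z) x"
    show "\<forall>i. x \<in> edge v i \<longrightarrow> G v lam \<nu> H i \<delta> u \<phi> (edge_deriv v \<phi> i x) x \<le> 0"
      and "\<forall>i. x = v i \<longrightarrow> min (G v lam \<nu> H i \<delta> u \<phi> (edge_deriv v \<phi> i x) x) (ereal (u x - h i)) \<le> 0"
      using u * unfolding kirchhoff_subsolution_def by auto
    assume "x = 0"
    with * have \<phi>: "\<phi> \<in> C1 v" "0 < \<delta>" "max_point_on (jball v \<delta> 0) (\<lambda>z. u z - \<phi> z) 0" by auto
    from kirchhoff_sub_imp_FL[OF kirchhoff_subsolution_imp_sub[OF u] \<phi> cont conv amin _ C(2)] C(1)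
    obtain q where plus: "\<And>i. G0 lam i \<delta> u \<phi> + ereal (H_plus H i 0 (edge_deriv v \<phi> i 0)) \<le> 0"
      and q: "\<And>i. G0 lam i \<delta> u \<phi> + ereal (H_minus H i 0 (q i)) \<le> 0" "(\<Sum>i\<in>UNIV. - q i) - B \<le> 0"
      by auto
    \<comment> \<open>The limiter is an infimum, so the single competitor \<open>q\<close> bounds
      it.\<close>
    have "FL_minus v lam \<nu> H B \<delta> u \<phi> \<le> max (MAX i. G v lam \<nu> (H_minus H) i \<delta> u \<phi> (q i) 0)
        (ereal ((\<Sum>i\<in>UNIV. - q i) - B))"
      unfolding FL_minus_def by (rule INF_lower) simp
    also have "\<dots> \<le> 0" using q by (simp add: G_eq_G0)
    finally show "max (MAX i. G v lam \<nu> (H_plus H) i \<delta> u \<phi> (edge_deriv v \<phi> i 0) 0)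
        (FL_minus v lam \<nu> H B \<delta> u \<phi>) \<le> 0"
      using plus by (simp add: G_eq_G0)
  qed
  have super: "FL_supersolution v lam \<nu> H B h u" if u: "kirchhoff_supersolution v lam \<nu> H B h u" for u
    unfolding FL_supersolution_def
  proof (intro conjI ballI impI)
    show "u \<in> LSC v" using u by (simp add: kirchhoff_supersolution_def)
    fix x \<delta> \<phi> assume *: "x \<in> junction v" "\<delta> \<in> {0<..<1}" "\<phi> \<in> C1 v"
      "min_point_on (jball v \<delta> x) (\<lambda>z. u z - \<phi> z) x"
    show "\<forall>i. x \<in> edge v i \<longrightarrow> G v lam \<nu> H i \<delta> u \<phi> (edge_deriv v \<phi> i x) x \<ge> 0"
      and "\<forall>i. x = v i \<longrightarrow> max (G v lam \<nu> H i \<delta> u \<phi> (edge_deriv v \<phi> i x) x) (ereal (u x - h i)) \<ge> 0"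
      using u * unfolding kirchhoff_supersolution_def by auto
    assume "x = 0"
    with * have \<phi>: "\<phi> \<in> C1 v" "0 < \<delta>" "min_point_on (jball v \<delta> 0) (\<lambda>z. u z - \<phi> z) 0" by auto
    show "0 \<le> max (MAX i. G v lam \<nu> (H_plus H) i \<delta> u \<phi> (edge_deriv v \<phi> i 0) 0)
        (FL_minus v lam \<nu> H B \<delta> u \<phi>)"
    proof (rule ccontr)
      assume "\<not> ?thesis"
      then have plus: "\<And>i. G0 lam i \<delta> u \<phi> + ereal (H_plus H i 0 (edge_deriv v \<phi> i 0)) < 0"
        and "FL_minus v lam \<nu> H B \<delta> u \<phi> < 0"
        by (auto simp: not_le G_eq_G0)
      \<comment> \<open>A negative infimum has a competitor with negative value, whether or not it
        is attained.\<close>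
      then obtain p where "\<And>i. G0 lam i \<delta> u \<phi> + ereal (H_minus H i 0 (p i)) < 0"
          "(\<Sum>i\<in>UNIV. - p i) - B < 0"
        unfolding FL_minus_def INF_less_iff by (auto simp: G_eq_G0)
      with kirchhoff_super_imp_FL[OF kirchhoff_supersolution_imp_sub_uminus[OF u] \<phi> cont conv amin plus]
      show False by (meson not_le)
    qed
  qed
  from sub super show ?thesis by blast
qed

end
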